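(* Let $n\ge 2$ and let $\Pi_0,\dots,\Pi_n\subset\mathbb{P}^n$ be general linear subspaces of codimension $2$. The map $v_n:\mathbb{P}^n\dashrightarrow\mathbb{P}^n$ is injective off of $Q_0\cup\dots\cup Q_n$; hence it is a Cremona transformation (i.e. a birational map of $\mathbb{P}^n$ to itself).
   Context: $\mathbb{P}^n$ is projective space over a ground field $K$ of characteristic $0$; points and lines are understood geometrically (i.e. over an algebraic closure if $K$ is not algebraically closed). "General" means: for all choices in some dense Zariski-open subset of the parameter space. For each $j=0,\dots,n$ there is a unique hypersurface of degree $n-1$ in $\mathbb{P}^n$ containing the $n$ subspaces $\Pi_i$, $i\neq j$; it is denoted $Q_j$. $\mathcal{L}_n$ is the linear system (vector space) of forms of degree $n$ vanishing on $\Pi_0\cup\dots\cup\Pi_n$; it has vector space dimension $n+1$, and $v_n:\mathbb{P}^n\dashrightarrow\mathbb{P}^n$ is the rational map given by $\mathcal{L}_n$. *)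

theory Defs
  imports
    "HOL-Analysis.Analysis"
    "HOL-Library.Poly_Mapping"
    "HOL-Algebra.Algebraic_Closure_Type"
begin

section \<open>Multivariate polynomials\<close>

text \<open>A polynomial over \<open>'a\<close> in the variables \<open>'i\<close> is a finitely supported map from
  monomials (exponent vectors) to coefficients, with the convolution product of
  \<^theory>\<open>HOL-Library.Poly_Mapping\<close>.\<close>

type_synonym ('i, 'a) mpoly = "('i \<Rightarrow>\<^sub>0 nat) \<Rightarrow>\<^sub>0 'a"

definition mvar :: "'i \<Rightarrow> ('i, 'a::comm_ring_1) mpoly" where
  "mvar i = Poly_Mapping.single (Poly_Mapping.single i 1) 1"

definition mconst :: "'a::comm_ring_1 \<Rightarrow> ('i, 'a) mpoly" where
  "mconst c = Poly_Mapping.single 0 c"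

text \<open>\<open>msubst \<phi> x p\<close> replaces every coefficient \<open>c\<close> of \<open>p\<close> by \<open>\<phi> c\<close> and every variable
  \<open>i\<close> by \<open>x i\<close>. It is used with \<open>\<phi> = id\<close> (values at points over the ground field),
  \<open>\<phi> = to_ac\<close> (values at geometric points) and \<open>\<phi> = mconst\<close> (composition of polynomials).\<close>

definition msubst ::
    "('a::comm_ring_1 \<Rightarrow> 'b::comm_ring_1) \<Rightarrow> ('i \<Rightarrow> 'b) \<Rightarrow> ('i, 'a) mpoly \<Rightarrow> 'b" where
  "msubst \<phi> x p =
     (\<Sum>m\<in>Poly_Mapping.keys p. \<phi> (Poly_Mapping.lookup p m) *
        (\<Prod>i\<in>Poly_Mapping.keys m. x i ^ Poly_Mapping.lookup m i))"

text \<open>The zero polynomial is a form of every degree.\<close>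

definition is_form :: "nat \<Rightarrow> ('i, 'a::comm_ring_1) mpoly \<Rightarrow> bool" where
  "is_form d p \<longleftrightarrow>
     (\<forall>m\<in>Poly_Mapping.keys p. (\<Sum>i\<in>Poly_Mapping.keys m. Poly_Mapping.lookup m i) = d)"

global_interpretation mpoly: vector_space
    "\<lambda>(c::'a::field) (p::('i, 'a) mpoly). mconst c * p"
  by unfold_locales
    (simp_all add: mconst_def algebra_simps single_add mult_single flip: mult.assoc)


section \<open>Geometric points of projective space\<close>

text \<open>With coordinates indexed by a type \<open>'n\<close> with \<open>n + 1\<close> elements, the points of
  \<open>n\<close>-dimensional projective space are the lines through the origin of \<open>'a ^ 'n\<close>. Everything
  geometric happens over the algebraic closure of the ground field.\<close>

definition proj_space :: "('a::field ^ 'n) set set" where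
  "proj_space = {vec.span {x} | x. x \<noteq> 0}"

definition geom_points :: "('k::field ^ 'n) set \<Rightarrow> ('k alg_closure ^ 'n) set" where
  "geom_points V = vec.span ((\<lambda>v. \<chi> i. to_ac (v $ i)) ` V)"

definition geom_eval :: "('n, 'k::field) mpoly \<Rightarrow> 'k alg_closure ^ 'n \<Rightarrow> 'k alg_closure" where
  "geom_eval p x = msubst to_ac (($) x) p"

definition zero_locus :: "('n, 'k::field) mpoly \<Rightarrow> ('k alg_closure ^ 'n) set set" where
  "zero_locus p = {P \<in> proj_space. \<forall>x\<in>P. geom_eval p x = 0}"


section \<open>Rational self-maps of projective space\<close>

text \<open>A rational map is given by forms of one common degree, not all zero. Two such tuples give
  the same rational map iff they are proportional, i.e. all \<open>2 \<times> 2\<close> minors vanish.\<close>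

definition is_ratmap :: "('n \<Rightarrow> ('n, 'k::field) mpoly) \<Rightarrow> bool" where
  "is_ratmap f \<longleftrightarrow> (\<exists>d. \<forall>i. is_form d (f i)) \<and> (\<exists>i. f i \<noteq> 0)"

definition ratmap_eq ::
    "('n \<Rightarrow> ('n, 'k::field) mpoly) \<Rightarrow> ('n \<Rightarrow> ('n, 'k) mpoly) \<Rightarrow> bool" where
  "ratmap_eq f g \<longleftrightarrow> (\<forall>i j. f i * g j = f j * g i)"

definition ratmap_comp ::
    "('n \<Rightarrow> ('n, 'k::field) mpoly) \<Rightarrow> ('n \<Rightarrow> ('n, 'k) mpoly) \<Rightarrow> ('n \<Rightarrow> ('n, 'k) mpoly)" where
  "ratmap_comp g f = (\<lambda>i. msubst mconst f (g i))"

text \<open>Birationality: there is a rational inverse over the ground field. The composite tuples are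
  required to be rational maps again, that is, not to vanish identically.\<close>

definition is_cremona :: "('n \<Rightarrow> ('n, 'k::field) mpoly) \<Rightarrow> bool" where
  "is_cremona f \<longleftrightarrow> is_ratmap f \<and>
     (\<exists>g. is_ratmap g \<and>
        is_ratmap (ratmap_comp g f) \<and> ratmap_eq (ratmap_comp g f) mvar \<and>
        is_ratmap (ratmap_comp f g) \<and> ratmap_eq (ratmap_comp f g) mvar)"

text \<open>The effect on geometric points. The image of a line \<open>P\<close> under a tuple of forms of equal
  degree spans a line if the tuple does not vanish on \<open>P\<close>, and spans the zero space, which is not
  a member of \<^const>\<open>proj_space\<close>, if it does.\<close>

definition ratmap_apply ::
    "('n \<Rightarrow> ('n, 'k::field) mpoly) \<Rightarrow> ('k alg_closure ^ 'n) set \<Rightarrow> ('k alg_closure ^ 'n) set" where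
  "ratmap_apply f P = vec.span ((\<lambda>x. \<chi> i. geom_eval (f i) x) ` P)"


section \<open>The parameter space of codimension two subspaces\<close>

text \<open>The index type \<open>'n\<close> of the coordinates, having \<open>n + 1\<close> elements, also serves to index the
  \<open>n + 1\<close> subspaces. A linear subspace of \<open>n\<close>-dimensional projective space is represented by its
  cone in \<open>'k ^ 'n\<close>; the codimension is the same.\<close>

definition codim2_tuples :: "('n \<Rightarrow> ('k::field ^ 'n) set) set" where
  "codim2_tuples = {W. \<forall>i. vec.subspace (W i) \<and> vec.dim (W i) + 2 = CARD('n)}"

text \<open>\<open>cut_out c i\<close> is the common kernel of the two linear forms with coefficient vectors
  \<open>c (i, False, _)\<close> and \<open>c (i, True, _)\<close>.\<close>

definition cut_out :: "('n \<times> bool \<times> 'n \<Rightarrow> 'k::field) \<Rightarrow> 'n \<Rightarrow> ('k ^ 'n) set" where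
  "cut_out c i = {v. \<forall>b. (\<Sum>j\<in>UNIV. c (i, b, j) * v $ j) = 0}"

text \<open>The Zariski topology on the \<open>(n + 1)\<close>-fold product of the Grassmannian, as the quotient of
  the space of tuples of pairs of independent linear forms: the basic open sets are the images of
  the principal open sets \<open>F \<noteq> 0\<close> of the latter. (A set is closed iff it is cut out by
  multihomogeneous equations in the Pluecker coordinates.)\<close>

definition zariski_codim2 :: "('n \<Rightarrow> ('k::field ^ 'n) set) topology" where
  "zariski_codim2 = topology_generated_by
     (range (\<lambda>F::('n \<times> bool \<times> 'n, 'k) mpoly.
        {W \<in> codim2_tuples. \<exists>c. W = cut_out c \<and> msubst id c F \<noteq> 0}))"

definition dense_open_in :: "'a topology \<Rightarrow> 'a set \<Rightarrow> bool" where
  "dense_open_in T U \<longleftrightarrow> openin T U \<and> Abstract_Topology.closure_of T U = topspace T"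


section \<open>Forms vanishing on the subspaces\<close>

definition forms_vanishing ::
    "nat \<Rightarrow> 'n set \<Rightarrow> ('n \<Rightarrow> ('k::field ^ 'n) set) \<Rightarrow> ('n, 'k) mpoly set" where
  "forms_vanishing d J W =
     {p. is_form d p \<and> (\<forall>i\<in>J. \<forall>x\<in>geom_points (W i). geom_eval p x = 0)}"

text \<open>The linear system \<open>\<L>\<^sub>n\<close>, where \<open>n = CARD('n) - 1\<close>.\<close>

definition lin_sys :: "('n \<Rightarrow> ('k::field ^ 'n) set) \<Rightarrow> ('n, 'k) mpoly set" where
  "lin_sys W = forms_vanishing (CARD('n) - 1) UNIV W"

definition lin_sys_basis ::
    "('n \<Rightarrow> ('k::field ^ 'n) set) \<Rightarrow> ('n \<Rightarrow> ('n, 'k) mpoly) \<Rightarrow> bool" where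
  "lin_sys_basis W f \<longleftrightarrow>
     inj f \<and> mpoly.independent (range f) \<and> mpoly.span (range f) = lin_sys W"

text \<open>\<open>q\<close> is an equation of the unique hypersurface \<open>Q\<^sub>j\<close> of degree \<open>n - 1\<close> containing
  all \<open>W i\<close> with \<open>i \<noteq> j\<close>. A hypersurface is a nonzero form up to nonzero scalars.\<close>

definition Q_equation ::
    "('n \<Rightarrow> ('k::field ^ 'n) set) \<Rightarrow> 'n \<Rightarrow> ('n, 'k) mpoly \<Rightarrow> bool" where
  "Q_equation W j q \<longleftrightarrow>
     q \<in> forms_vanishing (CARD('n) - 2) (- {j}) W \<and> q \<noteq> 0 \<and>
     (\<forall>p \<in> forms_vanishing (CARD('n) - 2) (- {j}) W. p \<noteq> 0 \<longrightarrow> (\<exists>c. p = mconst c * q))"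

end

theory Submission
  imports Defs
begin

text \<open>
  Let \<open>a\<^sub>i, b\<^sub>i\<close> be two linear forms that cut out the \<open>i\<close>-th subspace. For a point \<open>x\<close> the linear
  form \<open>H\<^sub>i(x) = b\<^sub>i(x) a\<^sub>i - a\<^sub>i(x) b\<^sub>i\<close> defines the hyperplane spanned by \<open>x\<close> and that subspace. All
  \<open>n + 1\<close> of these forms kill \<open>x\<close>, so the wedge product of those with \<open>i \<noteq> j\<close> is a multiple of \<open>x\<close>:
  the cofactors of row \<open>j\<close> of the matrix with rows \<open>H\<^sub>i(x)\<close> are \<open>Q\<^sub>j(x) x\<^sub>k\<close> for a form \<open>Q\<^sub>j\<close> of degree
  \<open>n - 1\<close> (\<open>ex_pencil_form\<close>). It vanishes where some row \<open>H\<^sub>i\<close> with \<open>i \<noteq> j\<close> is zero, that is, on the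
  subspaces with \<open>i \<noteq> j\<close>; and \<open>Q\<^sub>j(x) \<noteq> 0\<close> says that the \<open>n\<close> hyperplanes meet in the point \<open>x\<close> only.

  Injectivity. The products \<open>Q\<^sub>i a\<^sub>i\<close> and \<open>Q\<^sub>i b\<^sub>i\<close> lie in the linear system. Where no \<open>Q\<^sub>j\<close> vanishes,
  the image of \<open>x\<close> therefore determines every ratio \<open>a\<^sub>i(x) : b\<^sub>i(x)\<close>, hence every hyperplane, hence
  their common point \<open>x\<close> (\<open>vK_injective\<close>).

  Dimensions. Let the \<open>a\<^sub>i\<close> be a basis of the linear forms, and let \<open>e\<^sub>k\<close> be the dual basis, whose
  members are called vertices. A form of degree \<open>n\<close> in the linear system that vanishes at all
  vertices is zero: by induction on the dimension it vanishes on every face of the coordinate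
  simplex, because on a face of dimension at least one it vanishes on \<open>n + 1\<close> hyperplanes, namely the
  facets \<open>a\<^sub>i = 0\<close> of that face for the indices \<open>i\<close> of the face and the loci \<open>b\<^sub>i = 0\<close> for the others
  (\<open>form_determined_at_vertices\<close>). Since \<open>Q\<^sub>i a\<^sub>i\<close> vanishes at every vertex except \<open>e\<^sub>i\<close>, these \<open>n + 1\<close>
  products are a basis. The same argument, with faces through \<open>e\<^sub>j\<close> only, shows that a form of degree
  \<open>n - 1\<close> through the subspaces with \<open>i \<noteq> j\<close> is determined by its value at \<open>e\<^sub>j\<close>, so that \<open>Q\<^sub>j\<close> is unique.

  The inverse. Let \<open>v\<close> be a basis of the linear system and write \<open>Q\<^sub>i a\<^sub>i = P\<^sub>i(v)\<close> and \<open>Q\<^sub>i b\<^sub>i = R\<^sub>i(v)\<close>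
  with linear forms \<open>P\<^sub>i, R\<^sub>i\<close>. A point \<open>y\<close> of the target gives the forms \<open>R\<^sub>i(y) a\<^sub>i - P\<^sub>i(y) b\<^sub>i\<close>, and
  the cofactors of the matrix with these rows define the inverse: at \<open>y = v(x)\<close> the rows are
  \<open>Q\<^sub>i(x) H\<^sub>i(x)\<close>, so that the cofactors are \<open>(\<Prod>\<^sub>i Q\<^sub>i(x)) x\<close>. That this is an inverse on the other
  side as well rests on the relation \<open>\<Sum>\<^sub>i Q\<^sub>i H\<^sub>i = 0\<close>, which up to scaling is the only one between the
  \<open>H\<^sub>i(x)\<close> at a point where some \<open>Q\<^sub>j\<close> does not vanish.

  Genericity. What the argument uses about the subspaces is that the \<open>a\<^sub>i\<close> are a basis and that the
  matrix \<open>(b\<^sub>i(e\<^sub>k))\<close> has nonzero off-diagonal entries and nonzero \<open>2 \<times> 2\<close> minors away from the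
  diagonal. This is the nonvanishing of one polynomial in the coefficients of the \<open>a\<^sub>i, b\<^sub>i\<close>. It
  defines a dense open set, because every nonempty open set contains the image of a nonempty
  principal open set of coefficients.
\<close>


section \<open>Substitution homomorphisms and forms\<close>
definition rhom :: "('a::comm_ring_1 \<Rightarrow> 'b::comm_ring_1) \<Rightarrow> bool" where
  "rhom h \<longleftrightarrow> h 1 = 1 \<and> (\<forall>x y. h (x + y) = h x + h y) \<and> (\<forall>x y. h (x * y) = h x * h y)"

lemma rhomD:
  assumes "rhom h"
  shows "h 1 = 1" "h (x + y) = h x + h y" "h (x * y) = h x * h y"
    "h 0 = 0" "h (- x) = - h x" "h (x - y) = h x - h y" "h (x ^ m) = h x ^ m"
    "h (sum f A) = (\<Sum>i\<in>A. h (f i))" "h (prod f A) = (\<Prod>i\<in>A. h (f i))"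
proof -
  show 1: "h 1 = 1" and add: "h (x + y) = h x + h y" and mult: "h (x * y) = h x * h y" for x y
    using assms by (auto simp: rhom_def)
  show z: "h 0 = 0" using add[of 0 0] by simp
  show m: "h (- x) = - h x" for x using add[of x "- x"] z by (simp add: eq_neg_iff_add_eq_0 add.commute)
  show "h (x - y) = h x - h y" using add[of x "- y"] m by simp
  show "h (x ^ m) = h x ^ m" by (induction m) (auto simp: 1 mult)
  show "h (sum f A) = (\<Sum>i\<in>A. h (f i))" by (induction A rule: infinite_finite_induct) (auto simp: z add)
  show "h (prod f A) = (\<Prod>i\<in>A. h (f i))" by (induction A rule: infinite_finite_induct) (auto simp: 1 mult)
qed

lemma rhom_id: "rhom id" and rhom_to_ac: "rhom to_ac"
  by (auto simp: rhom_def)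

lemma rhom_mconst: "rhom mconst"
  by (auto simp: rhom_def mconst_def single_add mult_single)

lemma rhom_det:
  fixes A :: "'a::comm_ring_1 ^ 'n ^ 'n"
  assumes "rhom h"
  shows "h (det A) = det (\<chi> i j. h (A $ i $ j))"
proof -
  have "h (of_int (sign p)) = of_int (sign p)" for p :: "'n \<Rightarrow> 'n"
    by (auto simp: sign_def rhomD[OF assms])
  then show ?thesis by (simp add: det_def rhomD[OF assms])
qed

abbreviation mono_val :: "('i \<Rightarrow> 'b::comm_ring_1) \<Rightarrow> ('i \<Rightarrow>\<^sub>0 nat) \<Rightarrow> 'b" where
  "mono_val x m \<equiv> \<Prod>i\<in>Poly_Mapping.keys m. x i ^ Poly_Mapping.lookup m i"

lemma mono_val_superset:
  assumes "finite I" "Poly_Mapping.keys m \<subseteq> I"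
  shows "mono_val x m = (\<Prod>i\<in>I. x i ^ Poly_Mapping.lookup m i)"
  using assms by (intro prod.mono_neutral_left) (auto simp: in_keys_iff)

lemma mono_val_add: "mono_val x (m + m') = mono_val x m * mono_val x m'"
proof -
  let ?I = "Poly_Mapping.keys m \<union> Poly_Mapping.keys m'"
  have "Poly_Mapping.keys (m + m') \<subseteq> ?I" by (rule Poly_Mapping.keys_add)
  then show ?thesis
    using mono_val_superset[of ?I m x] mono_val_superset[of ?I m' x] mono_val_superset[of ?I "m + m'" x]
    by (simp add: lookup_add power_add prod.distrib)
qed

lemma msubst_superset:
  assumes "rhom \<phi>" "finite M" "Poly_Mapping.keys p \<subseteq> M"
  shows "msubst \<phi> x p = (\<Sum>m\<in>M. \<phi> (Poly_Mapping.lookup p m) * mono_val x m)"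
  unfolding msubst_def using assms
  by (intro sum.mono_neutral_left) (auto simp: in_keys_iff rhomD)

lemma msubst_single:
  "rhom \<phi> \<Longrightarrow> msubst \<phi> x (Poly_Mapping.single m c) = \<phi> c * mono_val x m"
  by (cases "c = 0") (auto simp: msubst_def rhomD)

lemma msubst_add:
  assumes "rhom \<phi>"
  shows "msubst \<phi> x (p + q) = msubst \<phi> x p + msubst \<phi> x q"
proof -
  let ?M = "Poly_Mapping.keys p \<union> Poly_Mapping.keys q"
  have "Poly_Mapping.keys (p + q) \<subseteq> ?M" by (rule Poly_Mapping.keys_add)
  then show ?thesis
    by (simp add: msubst_superset[OF assms, of ?M] lookup_add rhomD[OF assms] distrib_right sum.distrib)
qed

lemma msubst_sum:
  assumes "rhom \<phi>"
  shows "msubst \<phi> x (sum f A) = (\<Sum>i\<in>A. msubst \<phi> x (f i))"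
proof -
  have "msubst \<phi> x 0 = 0" by (simp add: msubst_def)
  then show ?thesis by (induction A rule: infinite_finite_induct) (auto simp: msubst_add[OF assms])
qed

lemma poly_mapping_sum_single:
  "p = (\<Sum>m\<in>Poly_Mapping.keys p. Poly_Mapping.single m (Poly_Mapping.lookup p m))"
proof (rule poly_mapping_eqI)
  fix k
  have "(\<Sum>m\<in>Poly_Mapping.keys p. Poly_Mapping.lookup (Poly_Mapping.single m (Poly_Mapping.lookup p m)) k)
    = (\<Sum>m\<in>Poly_Mapping.keys p. if m = k then Poly_Mapping.lookup p k else 0)"
    by (rule sum.cong) (auto simp: lookup_single when_def)
  then show "Poly_Mapping.lookup p k = Poly_Mapping.lookup (\<Sum>m\<in>Poly_Mapping.keys p. Poly_Mapping.single m (Poly_Mapping.lookup p m)) k"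
    by (simp add: lookup_sum in_keys_iff)
qed

lemma rhom_msubst:
  assumes "rhom \<phi>"
  shows "rhom (msubst \<phi> x)"
proof -
  have 1: "msubst \<phi> x 1 = 1"
    using msubst_single[OF assms, of x 0 1] by (simp add: rhomD[OF assms])
  have ss: "msubst \<phi> x (Poly_Mapping.single m c * Poly_Mapping.single m' c') =
    msubst \<phi> x (Poly_Mapping.single m c) * msubst \<phi> x (Poly_Mapping.single m' c')" for m m' c c'
    by (simp add: mult_single msubst_single[OF assms] mono_val_add rhomD[OF assms] mult_ac)
  have "msubst \<phi> x (p * q) = msubst \<phi> x p * msubst \<phi> x q" for p q
  proof -
    let ?s = "\<lambda>p m. Poly_Mapping.single m (Poly_Mapping.lookup p m)"
    have "p * q = (\<Sum>m\<in>Poly_Mapping.keys p. \<Sum>m'\<in>Poly_Mapping.keys q. ?s p m * ?s q m')"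
      by (subst poly_mapping_sum_single[of p], subst poly_mapping_sum_single[of q]) (rule sum_product)
    then have "msubst \<phi> x (p * q) = (\<Sum>m\<in>Poly_Mapping.keys p. \<Sum>m'\<in>Poly_Mapping.keys q.
        msubst \<phi> x (?s p m) * msubst \<phi> x (?s q m'))"
      by (simp add: msubst_sum[OF assms] ss)
    also have "\<dots> = msubst \<phi> x (\<Sum>m\<in>Poly_Mapping.keys p. ?s p m) * msubst \<phi> x (\<Sum>m\<in>Poly_Mapping.keys q. ?s q m)"
      by (simp add: msubst_sum[OF assms] sum_product)
    finally show ?thesis by (simp flip: poly_mapping_sum_single)
  qed
  then show ?thesis by (auto simp: rhom_def 1 msubst_add[OF assms])
qed

lemma msubst_mvar: "rhom \<phi> \<Longrightarrow> msubst \<phi> x (mvar i) = x i"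
  by (simp add: mvar_def msubst_single rhomD)

lemma msubst_mconst: "rhom \<phi> \<Longrightarrow> msubst \<phi> x (mconst c) = \<phi> c"
  by (simp add: mconst_def msubst_single)

lemma rhom_msubst_comp:
  assumes "rhom h"
  shows "h (msubst \<phi> x p) = msubst (h \<circ> \<phi>) (h \<circ> x) p"
  by (simp add: msubst_def rhomD[OF assms])

lemmas rhom_eval = rhom_msubst[OF rhom_id] and rhom_geom = rhom_msubst[OF rhom_to_ac]

lemma rhom_geom_eval: "rhom (\<lambda>p. geom_eval p x)"
  unfolding geom_eval_def by (rule rhom_geom)

lemma geom_eval_to_ac:
  "geom_eval p (\<chi> i. to_ac (y i)) = to_ac (msubst id y p)"
  by (simp add: geom_eval_def rhom_msubst_comp[OF rhom_to_ac] comp_def vec_lambda_inverse)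


lemma is_form_mult:
  assumes "is_form d p" "is_form e q" shows "is_form (d + e) (p * q)"
  unfolding is_form_def
proof
  fix m assume "m \<in> Poly_Mapping.keys (p * q)"
  then obtain a b where ab: "m = a + b" "a \<in> Poly_Mapping.keys p" "b \<in> Poly_Mapping.keys q"
    using keys_mult[of p q] by auto
  let ?I = "Poly_Mapping.keys a \<union> Poly_Mapping.keys b"
  have sup: "sum (Poly_Mapping.lookup c) (Poly_Mapping.keys c) = sum (Poly_Mapping.lookup c) ?I"
    if "Poly_Mapping.keys c \<subseteq> ?I" for c
    using that by (intro sum.mono_neutral_left) (auto simp: in_keys_iff)
  have "Poly_Mapping.keys (a + b) \<subseteq> ?I" by (rule Poly_Mapping.keys_add)
  then have "sum (Poly_Mapping.lookup m) (Poly_Mapping.keys m) = d + e"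
    using assms ab sup[of a] sup[of b] sup[of m]
    by (simp add: is_form_def lookup_add sum.distrib)
  then show "(\<Sum>i\<in>Poly_Mapping.keys m. Poly_Mapping.lookup m i) = d + e" .
qed

lemma is_form_0: "is_form d 0"
  and is_form_1: "is_form 0 1"
  and is_form_mvar: "is_form 1 (mvar i)"
  and is_form_mconst: "is_form 0 (mconst c)"
  by (auto simp: is_form_def mvar_def mconst_def split: if_splits)

lemma is_form_add:
  assumes "is_form d p" "is_form d q" shows "is_form d (p + q)"
  using assms Poly_Mapping.keys_add[of p q] unfolding is_form_def by blast

lemma is_form_uminus: "is_form d p \<Longrightarrow> is_form d (- p)"
  by (auto simp: is_form_def in_keys_iff)

lemma is_form_diff: "is_form d p \<Longrightarrow> is_form d q \<Longrightarrow> is_form d (p - q)"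
  using is_form_add[of d p "- q"] is_form_uminus[of d q] by simp

lemma is_form_sum: "(\<And>i. i \<in> A \<Longrightarrow> is_form d (f i)) \<Longrightarrow> is_form d (sum f A)"
  by (induction A rule: infinite_finite_induct) (auto simp: is_form_0 is_form_add)

lemma is_form_prod:
  "(\<And>i. i \<in> A \<Longrightarrow> is_form (d i) (f i)) \<Longrightarrow> is_form (sum d A) (prod f A)"
  by (induction A rule: infinite_finite_induct) (auto simp: is_form_1 is_form_mult)

lemma is_form_mconst_mult: "is_form d p \<Longrightarrow> is_form d (mconst c * p)"
  using is_form_mult[OF is_form_mconst, of d p c] by simp

lemma is_form_power: "is_form d p \<Longrightarrow> is_form (m * d) (p ^ m)"
  by (induction m) (auto simp: is_form_1 is_form_mult)

lemma is_form_msubst: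
  assumes "is_form e p" "\<And>i. is_form d (f i)"
  shows "is_form (e * d) (msubst mconst f p)"
proof -
  have "is_form (e * d) (mono_val f m)" if "m \<in> Poly_Mapping.keys p" for m
  proof -
    have "is_form (\<Sum>i\<in>Poly_Mapping.keys m. Poly_Mapping.lookup m i * d) (mono_val f m)"
      by (intro is_form_prod is_form_power assms)
    then show ?thesis using that assms(1) by (simp add: is_form_def flip: sum_distrib_right)
  qed
  then show ?thesis unfolding msubst_def by (intro is_form_sum is_form_mconst_mult)
qed

lemma is_form_det:
  fixes A :: "('i, 'a::comm_ring_1) mpoly ^ 'n ^ 'n"
  assumes "\<And>i j. is_form (d i) (A $ i $ j)"
  shows "is_form (sum d UNIV) (det A)"
proof -
  have "is_form (sum d UNIV) (of_int (sign p) * (\<Prod>i\<in>UNIV. A $ i $ p i))" for p :: "'n \<Rightarrow> 'n"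
    using is_form_prod[of UNIV d "\<lambda>i. A $ i $ p i"] assms
    by (auto simp: sign_def is_form_uminus)
  then show ?thesis unfolding det_def by (intro is_form_sum)
qed

lemma msubst_scale:
  assumes "is_form d p" "rhom \<phi>"
  shows "msubst \<phi> (\<lambda>i. c * x i) p = c ^ d * msubst \<phi> x p"
proof -
  have "mono_val (\<lambda>i. c * x i) m = c ^ d * mono_val x m" if "m \<in> Poly_Mapping.keys p" for m
    using that assms(1) by (simp add: is_form_def power_mult_distrib prod.distrib flip: power_sum)
  then show ?thesis unfolding msubst_def by (simp add: sum_distrib_left mult_ac)
qed

lemma geom_eval_scale: "is_form d p \<Longrightarrow> geom_eval p (c *s x) = c ^ d * geom_eval p x"
  using msubst_scale[OF _ rhom_to_ac, of d p c "($) x"] 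
  by (simp add: geom_eval_def vector_scalar_mult_def vec_lambda_inverse)

section \<open>Common non-roots of polynomials\<close>

text \<open>With weights \<open>w i = \<tau> ^ f i\<close> for an injective \<open>f\<close>, the difference of the
  weights of two distinct monomials is a nonzero polynomial in \<open>\<tau>\<close>; a large \<open>\<tau>\<close>
  avoids the roots of these finitely many polynomials.\<close>
lemma separating_weight:
  fixes M :: "('i::finite \<Rightarrow>\<^sub>0 nat) set"
  assumes "finite M"
  shows "\<exists>w :: 'i \<Rightarrow> nat. inj_on (\<lambda>m. \<Sum>i\<in>UNIV. w i * Poly_Mapping.lookup m i) M"
proof -
  obtain f :: "'i \<Rightarrow> nat" where f: "inj f"
    using finite_imp_inj_to_nat_seg[of "UNIV :: 'i set"] by auto
  define rr :: "('i \<Rightarrow>\<^sub>0 nat) \<times> ('i \<Rightarrow>\<^sub>0 nat) \<Rightarrow> int poly" where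
    "rr = (\<lambda>(m, m'). \<Sum>i\<in>UNIV. Polynomial.monom (int (Poly_Mapping.lookup m i) - int (Poly_Mapping.lookup m' i)) (f i))"
  define Z where "Z = (\<Union>z\<in>{z \<in> M \<times> M. fst z \<noteq> snd z}. {t. poly (rr z) t = 0})"
  have "rr z \<noteq> 0" if z0: "fst z \<noteq> snd z" for z
  proof -
    obtain m m' where z: "z = (m, m')" "m \<noteq> m'" using z0 by (cases z) auto
    have "\<exists>i. Poly_Mapping.lookup m i \<noteq> Poly_Mapping.lookup m' i"
    proof (rule ccontr)
      assume "\<not> ?thesis"
      then have "m = m'" by (intro poly_mapping_eqI) simp
      then show False using z(2) by simp
    qed
    then obtain i where i: "Poly_Mapping.lookup m i \<noteq> Poly_Mapping.lookup m' i" ..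
    have "Polynomial.coeff (rr z) (f i) =
      (\<Sum>k\<in>UNIV. if k = i then int (Poly_Mapping.lookup m i) - int (Poly_Mapping.lookup m' i) else 0)"
      unfolding z rr_def using f by (auto simp: coeff_sum inj_eq intro!: sum.cong)
    then show ?thesis using i by auto
  qed
  then have "finite Z" unfolding Z_def using assms by (auto intro!: poly_roots_finite)
  then have "\<not> range int \<subseteq> Z" by (meson finite_subset infinite_UNIV_nat finite_imageD inj_of_nat)
  then obtain \<tau> :: nat where \<tau>: "int \<tau> \<notin> Z" by auto
  have "inj_on (\<lambda>m. \<Sum>i\<in>UNIV. \<tau> ^ f i * Poly_Mapping.lookup m i) M"
  proof (rule inj_onI, rule ccontr)
    fix m m' assume m: "m \<in> M" "m' \<in> M" "m \<noteq> m'"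
      and eq: "(\<Sum>i\<in>UNIV. \<tau> ^ f i * Poly_Mapping.lookup m i) = (\<Sum>i\<in>UNIV. \<tau> ^ f i * Poly_Mapping.lookup m' i)"
    have "poly (rr (m, m')) (int \<tau>) =
        int (\<Sum>i\<in>UNIV. \<tau> ^ f i * Poly_Mapping.lookup m i) - int (\<Sum>i\<in>UNIV. \<tau> ^ f i * Poly_Mapping.lookup m' i)"
      by (simp add: rr_def poly_sum poly_monom sum_subtractf algebra_simps)
    then have "poly (rr (m, m')) (int \<tau>) = 0" using eq by simp
    then show False using \<tau> m by (auto simp: Z_def)
  qed
  then show ?thesis by (rule exI[where x = "\<lambda>i. \<tau> ^ f i"])
qed

text \<open>Substituting \<open>t ^ w i\<close> for the \<open>i\<close>-th variable, with a weight that separates the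
  monomials in question, turns each polynomial into a nonzero polynomial in \<open>t\<close>: no two terms can cancel.
  All density arguments below reduce to this lemma.\<close>
lemma common_nonroot:
  fixes P :: "('i::finite, 'k::field_char_0) mpoly set"
  assumes "finite P" "0 \<notin> P"
  shows "\<exists>x. \<forall>p\<in>P. msubst id x p \<noteq> 0"
proof -
  define M where "M = (\<Union>p\<in>P. Poly_Mapping.keys p)"
  have "finite M" unfolding M_def using assms by auto
  then obtain w :: "'i \<Rightarrow> nat" where w: "inj_on (\<lambda>m. \<Sum>i\<in>UNIV. w i * Poly_Mapping.lookup m i) M"
    using separating_weight by blast
  define wt where "wt = (\<lambda>m. \<Sum>i\<in>UNIV. w i * Poly_Mapping.lookup m i)"
  define u where "u = (\<lambda>p::('i, 'k) mpoly. \<Sum>m\<in>Poly_Mapping.keys p. Polynomial.monom (Poly_Mapping.lookup p m) (wt m))"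
  have "u p \<noteq> 0" if p: "p \<in> P" for p
  proof -
    have "p \<noteq> 0" using p assms by auto
    then obtain m where m: "m \<in> Poly_Mapping.keys p" by (auto simp flip: keys_eq_empty)
    have "wt m' = wt m \<longleftrightarrow> m' = m" if "m' \<in> Poly_Mapping.keys p" for m'
      using w that m p by (auto simp: inj_on_def M_def wt_def)
    then have "Polynomial.coeff (u p) (wt m) = (\<Sum>m'\<in>Poly_Mapping.keys p. if m' = m then Poly_Mapping.lookup p m else 0)"
      unfolding u_def by (auto simp: coeff_sum intro!: sum.cong)
    then show ?thesis using m by (auto simp: in_keys_iff)
  qed
  then have "finite (\<Union>p\<in>P. {t. poly (u p) t = 0})" using assms by (auto intro!: poly_roots_finite)
  then have "\<exists>t. t \<notin> (\<Union>p\<in>P. {t. poly (u p) t = 0})"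
    by (rule ex_new_if_finite[OF infinite_UNIV_char_0])
  then obtain t where t: "\<And>p. p \<in> P \<Longrightarrow> poly (u p) t \<noteq> 0" by auto
  have "msubst id (\<lambda>i. t ^ w i) p = poly (u p) t" for p
  proof -
    have "mono_val (\<lambda>i. t ^ w i) m = t ^ wt m" for m :: "'i \<Rightarrow>\<^sub>0 nat"
      by (subst mono_val_superset[of UNIV]) (auto simp: wt_def power_sum simp flip: power_mult)
    then show ?thesis by (simp add: msubst_def u_def poly_sum poly_monom)
  qed
  then have "\<forall>p\<in>P. msubst id (\<lambda>i. t ^ w i) p \<noteq> 0" using t by simp
  then show ?thesis by (rule exI[where x = "\<lambda>i. t ^ w i"])
qed

lemma mpoly_eq_0I:
  fixes p :: "('i::finite, 'k::field_char_0) mpoly"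
  assumes "\<And>x. msubst id x p = 0"
  shows "p = 0"
  using common_nonroot[of "{p}"] assms by auto

lemma mpoly_eqI:
  fixes p q :: "('i::finite, 'k::field_char_0) mpoly"
  assumes "\<And>x. msubst id x p = msubst id x q"
  shows "p = q"
  using mpoly_eq_0I[of "p - q"] assms by (simp add: rhomD[OF rhom_eval])

lemma mpoly_mult_eq_0:
  fixes p q :: "('i::finite, 'k::field_char_0) mpoly"
  assumes "p * q = 0"
  shows "p = 0 \<or> q = 0"
proof (rule ccontr)
  assume "\<not> ?thesis"
  then obtain x where "msubst id x p \<noteq> 0" "msubst id x q \<noteq> 0" using common_nonroot[of "{p, q}"] by auto
  then have "msubst id x (p * q) \<noteq> 0" by (simp add: rhomD[OF rhom_eval])
  then show False using assms by (simp add: rhomD[OF rhom_eval])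
qed

lemma mpoly_prod_neq_0:
  fixes f :: "'b \<Rightarrow> ('i::finite, 'k::field_char_0) mpoly"
  assumes "\<And>i. i \<in> A \<Longrightarrow> f i \<noteq> 0"
  shows "prod f A \<noteq> 0"
  using assms by (induction A rule: infinite_finite_induct) (auto dest: mpoly_mult_eq_0)

text \<open>The polynomial \<open>q\<close> is the value of \<open>p\<close> at the point with coordinates \<open>x i
  + y i t\<close> in the polynomial ring in \<open>t\<close>.\<close>
lemma form_along_line:
  fixes p :: "('i, 'k::field) mpoly"
  assumes "is_form d p"
  shows "\<exists>q. Polynomial.degree q \<le> d \<and> (\<forall>t. poly q t = msubst id (\<lambda>i. x i + t * y i) p)"
proof (intro exI conjI allI)
  let ?q = "msubst (\<lambda>c. [:c:]) (\<lambda>i. [:x i, y i:]) p"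
  have "Polynomial.degree ([:c:] * mono_val (\<lambda>i. [:x i, y i:]) m) \<le> d" if "m \<in> Poly_Mapping.keys p" for m c
  proof -
    have "Polynomial.degree ([:x i, y i:] ^ e) \<le> e" for i e
      by (rule order.trans[OF degree_power_le]) simp
    then have "Polynomial.degree (mono_val (\<lambda>i. [:x i, y i:]) m) \<le> (\<Sum>i\<in>Poly_Mapping.keys m. Poly_Mapping.lookup m i)"
      by (intro order.trans[OF degree_prod_sum_le]) (auto intro: sum_mono)
    then show ?thesis using that assms
      by (intro order.trans[OF degree_mult_le]) (auto simp: is_form_def)
  qed
  then show "Polynomial.degree ?q \<le> d" unfolding msubst_def by (intro degree_sum_le) auto
  show "poly ?q t = msubst id (\<lambda>i. x i + t * y i) p" for t
    by (simp add: msubst_def poly_sum poly_prod)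
qed

lemma sum_keys_UNIV:
  fixes m :: "'i::finite \<Rightarrow>\<^sub>0 nat"
  shows "(\<Sum>i\<in>Poly_Mapping.keys m. Poly_Mapping.lookup m i) = (\<Sum>i\<in>UNIV. Poly_Mapping.lookup m i)"
  by (rule sum.mono_neutral_left) (auto simp: in_keys_iff)

text \<open>The terms of \<open>p\<close> that are free of the variable \<open>j\<close> form a polynomial whose value
  at any point is the value of \<open>p\<close> at the projection of that point to the hyperplane \<open>x\<^sub>j =
  0\<close>. Hence this part is zero.\<close>
lemma form_divisible_by_mvar:
  fixes p :: "('i::finite, 'k::field_char_0) mpoly"
  assumes form: "is_form (Suc d) p" and van: "\<And>x. x j = 0 \<Longrightarrow> msubst id x p = 0"
  shows "\<exists>q. is_form d q \<and> p = mvar j * q"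
proof -
  let ?e = "Poly_Mapping.single j 1 :: 'i \<Rightarrow>\<^sub>0 nat"
  define A where "A = {m \<in> Poly_Mapping.keys p. Poly_Mapping.lookup m j \<noteq> 0}"
  define q where "q = (\<Sum>m\<in>A. Poly_Mapping.single (m - ?e) (Poly_Mapping.lookup p m))"
  define r where "r = (\<Sum>m\<in>Poly_Mapping.keys p - A. Poly_Mapping.single m (Poly_Mapping.lookup p m))"
  have fin: "finite (Poly_Mapping.keys p)" "A \<subseteq> Poly_Mapping.keys p" by (auto simp: A_def)
  have e: "?e + (m - ?e) = m" if "m \<in> A" for m
    using that by (intro poly_mapping_eqI) (auto simp: A_def lookup_add lookup_minus lookup_single when_def)
  have "mvar j * q = (\<Sum>m\<in>A. Poly_Mapping.single m (Poly_Mapping.lookup p m))"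
    unfolding q_def sum_distrib_left mvar_def mult_single by (rule sum.cong) (use e in auto)
  then have p: "p = r + mvar j * q"
    unfolding r_def by (subst poly_mapping_sum_single) (simp add: sum.subset_diff[OF fin(2,1)])
  have "r = 0"
  proof (rule mpoly_eq_0I)
    fix x :: "'i \<Rightarrow> 'k"
    have "msubst id x r = msubst id (x(j := 0)) r"
      unfolding r_def msubst_sum[OF rhom_id] msubst_single[OF rhom_id]
    proof (rule sum.cong)
      fix m assume m: "m \<in> Poly_Mapping.keys p - A"
      then have "j \<notin> Poly_Mapping.keys m" by (auto simp: A_def in_keys_iff)
      then have "mono_val x m = mono_val (x(j := 0)) m" by (intro prod.cong) auto
      then show "id (Poly_Mapping.lookup p m) * mono_val x m = id (Poly_Mapping.lookup p m) * mono_val (x(j := 0)) m"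
        by simp
    qed simp
    also have "\<dots> = msubst id (x(j := 0)) p"
      unfolding p by (simp add: rhomD[OF rhom_eval] msubst_mvar[OF rhom_id])
    also have "\<dots> = 0" by (rule van) simp
    finally show "msubst id x r = 0" .
  qed
  moreover have "is_form d q"
    unfolding q_def
  proof (rule is_form_sum)
    fix m assume m: "m \<in> A"
    have "(\<Sum>i\<in>UNIV. Poly_Mapping.lookup m i) = Suc d"
      using m form by (auto simp: A_def is_form_def simp flip: sum_keys_UNIV)
    moreover have "(\<Sum>i\<in>UNIV. Poly_Mapping.lookup m i) =
      (\<Sum>i\<in>UNIV. Poly_Mapping.lookup ?e i) + (\<Sum>i\<in>UNIV. Poly_Mapping.lookup (m - ?e) i)"
      by (subst e[OF m, symmetric]) (simp add: lookup_add sum.distrib)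
    moreover have "(\<Sum>i\<in>UNIV. Poly_Mapping.lookup ?e i) = 1"
      by (simp flip: sum_keys_UNIV)
    ultimately have "(\<Sum>i\<in>Poly_Mapping.keys (m - ?e). Poly_Mapping.lookup (m - ?e) i) = d"
      unfolding sum_keys_UNIV by linarith
    then show "is_form d (Poly_Mapping.single (m - ?e) (Poly_Mapping.lookup p m))"
      by (auto simp: is_form_def)
  qed
  ultimately show ?thesis using p by auto
qed

section \<open>Forms vanishing on many hyperplanes\<close>

text \<open>The restrictions of the forms to vectors supported in \<open>T\<close> are nonzero polynomials, and they
  do not change when the coordinates outside \<open>T\<close> are set to zero.\<close>
lemma linear_forms_common_nonroot:
  fixes L :: "'c \<Rightarrow> 'n::finite \<Rightarrow> 'k::field_char_0"
  assumes "finite C" "\<And>c. c \<in> C \<Longrightarrow> \<exists>k\<in>T. L c k \<noteq> 0"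
  shows "\<exists>y. (\<forall>k. k \<notin> T \<longrightarrow> y k = 0) \<and> (\<forall>c\<in>C. (\<Sum>k\<in>UNIV. L c k * y k) \<noteq> 0)"
proof -
  define p where "p = (\<lambda>c. \<Sum>k\<in>T. mconst (L c k) * mvar k :: ('n, 'k) mpoly)"
  have ev: "msubst id x (p c) = (\<Sum>k\<in>T. L c k * x k)" for x c
    by (simp add: p_def rhomD[OF rhom_eval] msubst_mvar[OF rhom_id] msubst_mconst[OF rhom_id])
  have "p c \<noteq> 0" if "c \<in> C" for c
  proof -
    obtain k where k: "k \<in> T" "L c k \<noteq> 0" using assms(2)[of c] \<open>c \<in> C\<close> by blast
    have "msubst id (\<lambda>i. if i = k then 1 else 0) (p c) = L c k"
      using k by (simp add: ev if_distrib cong: if_cong)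
    then show ?thesis using k by (auto simp: rhomD[OF rhom_eval])
  qed
  then obtain x where x: "\<And>c. c \<in> C \<Longrightarrow> msubst id x (p c) \<noteq> 0"
    using common_nonroot[of "p ` C"] assms(1) by fastforce
  let ?y = "\<lambda>k. if k \<in> T then x k else 0"
  have "(\<Sum>k\<in>UNIV. L c k * ?y k) = msubst id x (p c)" for c
    unfolding ev by (rule sum.mono_neutral_cong_right) auto
  then show ?thesis using x by (intro exI[of _ ?y]) auto
qed

text \<open>Suppose \<open>f x \<noteq> 0\<close>. Then \<open>x\<close> lies on none of the hyperplanes of the
  subspace of vectors supported in \<open>T\<close>, and a line through \<open>x\<close> in a general direction of
  that subspace meets them in distinct points, since they are distinct. So the restriction of \<open>f\<close> to that
  line is a nonzero polynomial of degree at most \<open>d\<close> with more than \<open>d\<close> roots. The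
  hypothesis \<open>indep\<close> says that no two of the forms are proportional on the subspace, in the shape in
  which the choice of the direction uses it.\<close>
lemma vanishing_on_hyperplanes:
  fixes f :: "('n::finite \<Rightarrow> 'k::field_char_0) \<Rightarrow> 'k" and L :: "'c \<Rightarrow> 'n \<Rightarrow> 'k"
  assumes line: "\<And>x y. \<exists>q. Polynomial.degree q \<le> d \<and> (\<forall>t. poly q t = f (\<lambda>k. x k + t * y k))"
    and C: "finite C" "d < card C"
    and van: "\<And>c s. c \<in> C \<Longrightarrow> (\<forall>k. k \<notin> T \<longrightarrow> s k = 0) \<Longrightarrow> (\<Sum>k\<in>UNIV. L c k * s k) = 0 \<Longrightarrow> f s = 0"
    and indep: "\<And>c c' \<alpha> \<beta>. \<lbrakk>c \<in> C; c' \<in> C; c \<noteq> c'; \<alpha> \<noteq> 0; \<beta> \<noteq> 0\<rbrakk> \<Longrightarrow> \<exists>k\<in>T. \<alpha> * L c' k - \<beta> * L c k \<noteq> 0"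
    and x: "\<forall>k. k \<notin> T \<longrightarrow> x k = 0"
  shows "f x = 0"
proof (rule ccontr)
  assume fx: "f x \<noteq> 0"
  define e where "e = (\<lambda>c s. \<Sum>k\<in>UNIV. L c k * s k)"
  have eD: "e c s = (\<Sum>k\<in>UNIV. L c k * s k)" for c s by (simp add: e_def)
  have lin: "(\<Sum>k\<in>UNIV. L c k * (x k + t * y k)) = e c x + t * e c y" for c t y
    by (simp add: eD distrib_left sum.distrib sum_distrib_left mult.left_commute)
  have ex: "e c x \<noteq> 0" if "c \<in> C" for c using van[OF that x] fx by (auto simp: e_def)
  have L0: "\<exists>k\<in>T. L c k \<noteq> 0" if c: "c \<in> C" for c
  proof (rule ccontr)
    assume "\<not> ?thesis"
    then have "L c k * x k = 0" for k using x by (cases "k \<in> T") auto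
    then have "e c x = 0" unfolding e_def by (intro sum.neutral) blast
    then show False using ex[OF c] by simp
  qed
  \<comment> \<open>For \<open>D c c'\<close> not to vanish at the direction \<open>y\<close> means that the line meets the hyperplanes \<open>c\<close> and \<open>c'\<close>
    at different parameters.\<close>
  define D where "D = (\<lambda>c c' k. e c x * L c' k - e c' x * L c k)"
  define G where "G = L ` C \<union> (\<lambda>(c, c'). D c c') ` (C \<times> C - Id)"
  have "\<exists>k\<in>T. id g k \<noteq> 0" if g: "g \<in> G" for g
  proof -
    consider c where "c \<in> C" "g = L c"
      | c c' where "c \<in> C" "c' \<in> C" "c \<noteq> c'" "g = D c c'" using g by (auto simp: G_def)
    then show ?thesis
    proof cases
      case 1 then show ?thesis using L0 by simp
    next
      case (2 c c')
      show ?thesis unfolding 2(4) id_apply D_def by (rule indep[OF 2(1-3) ex[OF 2(1)] ex[OF 2(2)]])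
    qed
  qed
  then have "\<exists>y. (\<forall>k. k \<notin> T \<longrightarrow> y k = 0) \<and> (\<forall>g\<in>G. (\<Sum>k\<in>UNIV. id g k * y k) \<noteq> 0)"
    using C(1) by (intro linear_forms_common_nonroot) (auto simp: G_def)
  then obtain y where y: "\<forall>k. k \<notin> T \<longrightarrow> y k = 0"
    and yG: "\<And>g. g \<in> G \<Longrightarrow> (\<Sum>k\<in>UNIV. g k * y k) \<noteq> 0" by (auto simp: id_apply)
  have y1: "e c y \<noteq> 0" if "c \<in> C" for c
    unfolding e_def by (rule yG) (use that in \<open>auto simp: G_def\<close>)
  have y2: "(\<Sum>k\<in>UNIV. D c c' k * y k) \<noteq> 0" if "c \<in> C" "c' \<in> C" "c \<noteq> c'" for c c'
    by (rule yG) (use that in \<open>force simp: G_def\<close>)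
  have D: "(\<Sum>k\<in>UNIV. D c c' k * y k) = e c x * e c' y - e c' x * e c y" for c c'
    by (simp add: D_def eD[of _ y] sum_subtractf left_diff_distrib sum_distrib_left mult.assoc)
  have y3: "e c x * e c' y \<noteq> e c' x * e c y" if "c \<in> C" "c' \<in> C" "c \<noteq> c'" for c c'
    using y2[OF that] unfolding D by simp
  obtain q where q: "Polynomial.degree q \<le> d" "\<And>t. poly q t = f (\<lambda>k. x k + t * y k)" using line by blast
  have "q \<noteq> 0" using q(2)[of 0] fx by auto
  let ?t = "\<lambda>c. - e c x / e c y"
  have "inj_on ?t C" using y1 y3 by (auto simp: inj_on_def field_simps)
  then have "card (?t ` C) = card C" by (rule card_image)
  moreover have "?t ` C \<subseteq> {t. poly q t = 0}"
  proof safe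
    fix c assume c: "c \<in> C"
    have "(\<Sum>k\<in>UNIV. L c k * (x k + ?t c * y k)) = e c x + ?t c * e c y"
      by (rule lin)
    also have "\<dots> = 0" using y1[OF c] by simp
    finally show "poly q (?t c) = 0" unfolding q(2) using x y by (intro van[OF c]) auto
  qed
  ultimately have "card C \<le> card {t. poly q t = 0}" using card_mono[OF poly_roots_finite[OF \<open>q \<noteq> 0\<close>]] by metis
  then show False using card_poly_roots_bound[OF \<open>q \<noteq> 0\<close>] q(1) C(2) by linarith
qed

text \<open>These are the conditions under which no row becomes proportional to a unit vector, and no two rows to each
  other, when restricted to a set of at least two columns that avoids the diagonal positions of the rows
  involved.\<close>
definition generic_matrix :: "('n \<Rightarrow> 'n \<Rightarrow> 'k::comm_ring_1) \<Rightarrow> bool" where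
  "generic_matrix B \<longleftrightarrow> (\<forall>i j. i \<noteq> j \<longrightarrow> B i j \<noteq> 0) \<and>
     (\<forall>i i' j j'. distinct [i, i', j, j'] \<longrightarrow> B i j * B i' j' \<noteq> B i j' * B i' j)"

text \<open>This bounds the dimensions of all the spaces of forms in question. Here \<open>s\<close> holds the
  coordinates of a point with respect to the vertices and \<open>T\<close> is the vertex set of a face. The hypothesis
  \<open>- I \<subseteq> T\<close> survives the removal of a vertex \<open>i \<in> I\<close>, so by induction
  \<open>f\<close> vanishes on all facets \<open>s\<^sub>i = 0\<close> with \<open>i \<in> I \<inter> T\<close>. For
  \<open>i \<in> I - T\<close> the coordinate \<open>s\<^sub>i\<close> is zero on the whole face, so \<open>f\<close>
  vanishes where the \<open>i\<close>-th row of \<open>B\<close> does. Together these are \<open>card I > d\<close>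
  hyperplanes of the face, distinct because \<open>B\<close> is generic.\<close>
lemma form_determined_at_vertices:
  fixes f :: "('n::finite \<Rightarrow> 'k::field_char_0) \<Rightarrow> 'k" and B :: "'n \<Rightarrow> 'n \<Rightarrow> 'k"
  assumes line: "\<And>x y. \<exists>q. Polynomial.degree q \<le> d \<and> (\<forall>t. poly q t = f (\<lambda>k. x k + t * y k))"
    and I: "d < card I" 
    and B: "generic_matrix B"
    and van: "\<And>i s. i \<in> I \<Longrightarrow> s i = 0 \<Longrightarrow> (\<Sum>k\<in>UNIV. B i k * s k) = 0 \<Longrightarrow> f s = 0"
    and base: "\<And>k s. - I \<subseteq> {k} \<Longrightarrow> (\<forall>i. i \<noteq> k \<longrightarrow> s i = 0) \<Longrightarrow> f s = 0"
    and "- I \<subseteq> T" "T \<noteq> {}" "\<forall>k. k \<notin> T \<longrightarrow> s k = 0"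
  shows "f s = 0"
proof -
  have "finite T" by simp
  then show ?thesis using assms(6-8)
  proof (induction T arbitrary: s rule: finite_psubset_induct)
    case (psubset T)
    show ?case
    proof (cases "\<exists>k. T = {k}")
      case True
      then obtain k where "T = {k}" by blast
      then show ?thesis using base[of k s] psubset.prems by auto
    next
      case False
      have other: "\<exists>k\<in>T. k \<noteq> i" for i
      proof (rule ccontr)
        assume "\<not> ?thesis"
        then have "T \<subseteq> {i}" by blast
        then have "T = {i}" using psubset.prems(2) by (simp add: subset_singleton_iff)
        then show False using False by blast
      qed
      define L where "L = (\<lambda>i k. if i \<in> T then (if k = i then 1 else 0) else B i k)"
      show ?thesis
      proof (rule vanishing_on_hyperplanes[OF line, where C = I and L = L and T = T])
        fix i s assume i: "i \<in> I" and s: "\<forall>k. k \<notin> T \<longrightarrow> s k = 0" and 0: "(\<Sum>k\<in>UNIV. L i k * s k) = 0"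
        show "f s = 0"
        proof (cases "i \<in> T")
          case True
          have "s i = 0" using 0 True by (simp add: L_def if_distrib[of "\<lambda>z. z * _"] cong: if_cong)
          then have "\<forall>k. k \<notin> T - {i} \<longrightarrow> s k = 0" using s by auto
          moreover have "T - {i} \<noteq> {}" using other[of i] by auto
          moreover have "- I \<subseteq> T - {i}" using i psubset.prems(1) by auto
          ultimately show ?thesis using psubset.IH[of "T - {i}" s] True by auto
        next
          case False
          then show ?thesis using van[OF i] s 0 by (simp add: L_def)
        qed
      next
        fix i i' and \<alpha> \<beta> :: 'k assume *: "i \<in> I" "i' \<in> I" "i \<noteq> i'" "\<alpha> \<noteq> 0" "\<beta> \<noteq> 0"
        show "\<exists>k\<in>T. \<alpha> * L i' k - \<beta> * L i k \<noteq> 0"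
        proof (cases "i \<in> T")
          case True
          show ?thesis
          proof (cases "i' \<in> T")
            case True
            then show ?thesis using \<open>i \<in> T\<close> * by (intro bexI[of _ i]) (auto simp: L_def)
          next
            case False
            obtain k where k: "k \<in> T" "k \<noteq> i" using other by blast
            have "B i' k \<noteq> 0" using k(1) False B unfolding generic_matrix_def by metis
            then show ?thesis using k True False * by (intro bexI[of _ k]) (auto simp: L_def)
          qed
        next
          case iT: False
          show ?thesis
          proof (cases "i' \<in> T")
            case True
            obtain k where k: "k \<in> T" "k \<noteq> i'" using other by blast
            have "B i k \<noteq> 0" using k(1) iT B unfolding generic_matrix_def by metis
            then show ?thesis using k True iT * by (intro bexI[of _ k]) (auto simp: L_def)
          next
            case False
            obtain k where k: "k \<in> T" using psubset.prems by auto
            obtain k' where k': "k' \<in> T" "k' \<noteq> k" using other by blast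
            \<comment> \<open>Proportionality on the columns \<open>k\<close> and \<open>k'\<close> contradicts the nonvanishing of a \<open>2 \<times> 2\<close> minor.\<close>
            show ?thesis
            proof (rule ccontr)
              assume "\<not> ?thesis"
              then have e: "\<alpha> * B i' k = \<beta> * B i k" "\<alpha> * B i' k' = \<beta> * B i k'"
                using k k' iT False by (auto simp: L_def)
              have "\<alpha> * (B i k * B i' k') = B i k * (\<alpha> * B i' k')" by simp
              also have "\<dots> = B i k' * (\<beta> * B i k)" by (simp add: e)
              also have "\<dots> = \<alpha> * (B i k' * B i' k)" by (simp flip: e)
              finally have "B i k * B i' k' = B i k' * B i' k" using * by simp
              moreover have "distinct [i, i', k, k']" using k k' iT False * by auto
              ultimately show False using B unfolding generic_matrix_def by blast
            qed
          qed
        qed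
      qed (use I psubset.prems in auto)
    qed
  qed
qed

section \<open>Cofactors and the matrix of spanned hyperplanes\<close>
definition dotp :: "'a::comm_ring_1 ^ 'n \<Rightarrow> 'a ^ 'n \<Rightarrow> 'a" where
  "dotp u v = (\<Sum>k\<in>UNIV. u $ k * v $ k)"

lemma dotp_simps:
  "dotp (u + v) x = dotp u x + dotp v x" "dotp (u - v) x = dotp u x - dotp v x"
  "dotp x (u + v) = dotp x u + dotp x v" "dotp x (u - v) = dotp x u - dotp x v"
  "dotp (c *s u) x = c * dotp u x" "dotp x (c *s u) = c * dotp x u"
  "dotp 0 x = 0" "dotp x 0 = 0"
  by (simp_all add: dotp_def algebra_simps sum.distrib sum_subtractf sum_distrib_left)

lemma dotp_sum: "dotp (sum f A) x = (\<Sum>i\<in>A. dotp (f i) x)" "dotp x (sum f A) = (\<Sum>i\<in>A. dotp x (f i))"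
  by (induction A rule: infinite_finite_induct) (auto simp: dotp_simps)

lemma dotp_axis [simp]: "dotp (axis k 1) x = x $ k" "dotp x (axis k 1) = x $ k"
  by (simp_all add: dotp_def axis_def if_distrib[of "\<lambda>z. z * _"] if_distrib[of "\<lambda>z. _ * z"] cong: if_cong)

abbreviation replace_row :: "'a ^ 'm ^ 'n \<Rightarrow> 'n \<Rightarrow> 'a ^ 'm \<Rightarrow> 'a ^ 'm ^ 'n" where
  "replace_row M j r \<equiv> (\<chi> i. if i = j then r else M $ i)"

text \<open>The cofactor comes with its sign; this form avoids choosing an ordering of the index type.\<close>
definition cof :: "'a::comm_ring_1 ^ 'n ^ 'n \<Rightarrow> 'n \<Rightarrow> 'n \<Rightarrow> 'a" where
  "cof M j k = det (replace_row M j (axis k 1))"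

lemma det_replace_row_sum:
  fixes M :: "'a::comm_ring_1 ^ 'n ^ 'n"
  assumes "finite S"
  shows "det (replace_row M j (\<Sum>l\<in>S. c l *s v l)) = (\<Sum>l\<in>S. c l * det (replace_row M j (v l)))"
  by (simp add: det_linear_row_sum[OF assms, where a = "\<lambda>_ l. c l *s v l"] det_row_mul[where a = "\<lambda>_. v _"])

lemma det_replace_row:
  fixes M :: "'a::comm_ring_1 ^ 'n ^ 'n"
  shows "det (replace_row M j r) = (\<Sum>k\<in>UNIV. r $ k * cof M j k)"
proof -
  have r: "r = (\<Sum>k\<in>UNIV. r $ k *s axis k 1)"
    by (simp add: vec_eq_iff axis_def if_distrib[of "\<lambda>z. _ * z"] cong: if_cong)
  show ?thesis
    using arg_cong[OF r, of "\<lambda>r. det (replace_row M j r)"]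
      det_replace_row_sum[of UNIV, where M = M and j = j and c = "\<lambda>k. r $ k" and v = "\<lambda>k. axis k 1"]
    by (simp only: cof_def finite)
qed

lemma det_eq_0_of_kernel:
  fixes M :: "'a::field ^ 'n ^ 'n"
  assumes "\<And>i. dotp (M $ i) x = 0" "x \<noteq> 0"
  shows "det M = 0"
proof -
  have "M *v x = 0" using assms(1) by (simp add: vec_eq_iff matrix_vector_mult_def dotp_def)
  then show ?thesis
    using assms(2) invertible_det_nz[of M] matrix_left_invertible_ker[of M] invertible_left_inverse[of M] by blast
qed

lemma kernel_eq_0:
  fixes M :: "'a::field ^ 'n ^ 'n"
  assumes "\<And>i. dotp (M $ i) x = 0" "det M \<noteq> 0"
  shows "x = 0"
  using det_eq_0_of_kernel assms by blast

lemma det_neq_0_of_trivial_kernel: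
  fixes M :: "'a::field ^ 'n ^ 'n"
  assumes "\<And>z. (\<And>i. dotp (M $ i) z = 0) \<Longrightarrow> z = 0"
  shows "det M \<noteq> 0"
proof -
  have "z = 0" if z: "M *v z = 0" for z
  proof (rule assms)
    fix i
    have "dotp (M $ i) z = (M *v z) $ i" by (simp add: matrix_vector_mult_def dotp_def)
    then show "dotp (M $ i) z = 0" using z by simp
  qed
  then show ?thesis
    using invertible_det_nz[of M] matrix_left_invertible_ker[of M] invertible_left_inverse[of M] by blast
qed

lemma left_kernel:
  fixes M :: "'a::field ^ 'n ^ 'n"
  assumes "det M = 0"
  obtains \<mu> where "\<mu> \<noteq> (0 :: 'a ^ 'n)" "(\<Sum>i\<in>UNIV. \<mu> $ i *s M $ i) = 0"
proof -
  have "\<not> invertible (transpose M)" using assms invertible_det_nz[of "transpose M"] by simp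
  then obtain l where l: "transpose M *v l = 0" "l \<noteq> 0"
    using matrix_left_invertible_ker[of "transpose M"] invertible_left_inverse[of "transpose M"] by blast
  have "(\<Sum>i\<in>UNIV. l $ i *s M $ i) = 0"
    using l(1) by (simp add: vec_eq_iff matrix_vector_mult_def transpose_def mult.commute)
  then show ?thesis using l(2) that by blast
qed

lemma cof_zero_row:
  fixes M :: "'a::field ^ 'n ^ 'n"
  shows "M $ i = 0 \<Longrightarrow> i \<noteq> j \<Longrightarrow> cof M j k = 0"
  unfolding cof_def by (rule det_zero_row(2)[of i]) (simp add: row_def vec_eq_iff)

text \<open>Replace row \<open>j\<close> by the covector \<open>x\<^sub>l e\<^sub>k - x\<^sub>k e\<^sub>l\<close>. Now
  every row kills \<open>x\<close>, so the determinant, which is the difference of the two sides, is zero.\<close>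
lemma cof_proportional:
  fixes M :: "'a::field ^ 'n ^ 'n"
  assumes "\<And>i. i \<noteq> j \<Longrightarrow> dotp (M $ i) x = 0"
  shows "x $ l * cof M j k = x $ k * cof M j l"
proof (cases "x = 0")
  case False
  let ?r = "x $ l *s axis k 1 - x $ k *s axis l 1"
  have "det (replace_row M j ?r) = 0"
    using assms False by (intro det_eq_0_of_kernel[of _ x]) (auto simp: dotp_simps)
  moreover have "det (replace_row M j ?r) = x $ l * cof M j k - x $ k * cof M j l"
    unfolding det_replace_row
    by (simp add: axis_def left_diff_distrib sum_subtractf if_distrib[of "\<lambda>z. _ * z"] if_distrib[of "\<lambda>z. z * _"] cong: if_cong)
  ultimately show ?thesis by simp
qed simp

text \<open>In the matrix that defines \<open>cof M j k\<close>, replace row \<open>i\<close> by the vanishing sum.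
  Only the summands \<open>l = i\<close> and \<open>l = j\<close> contribute, all others repeat a row, and the summand
  \<open>l = j\<close> is \<open>cof M i k\<close> up to a swap of the rows \<open>i\<close> and
  \<open>j\<close>.\<close>
lemma cof_row_relation:
  fixes M :: "'a::comm_ring_1 ^ 'n ^ 'n"
  assumes "(\<Sum>l\<in>UNIV. \<mu> l *s M $ l) = 0"
  shows "\<mu> i * cof M j k = \<mu> j * cof M i k"
proof (cases "i = j")
  case False
  let ?N = "replace_row M j (axis k 1)"
  let ?f = "\<lambda>l. \<mu> l * det (replace_row ?N i (M $ l))"
  have "0 = det (replace_row ?N i (\<Sum>l\<in>UNIV. \<mu> l *s M $ l))"
    unfolding assms by (rule det_row_0[symmetric])
  also have "\<dots> = (\<Sum>l\<in>UNIV. ?f l)" by (rule det_replace_row_sum) simp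
  also have "\<dots> = (\<Sum>l\<in>{i, j}. ?f l)"
  proof (rule sum.mono_neutral_right)
    show "\<forall>l\<in>UNIV - {i, j}. ?f l = 0"
    proof
      fix l assume "l \<in> UNIV - {i, j}"
      then have "det (replace_row ?N i (M $ l)) = 0"
        by (intro det_identical_rows[of i l]) (auto simp: row_def)
      then show "?f l = 0" by simp
    qed
  qed auto
  also have "\<dots> = \<mu> i * cof M j k + \<mu> j * det (replace_row ?N i (M $ j))"
  proof -
    have "replace_row ?N i (M $ i) = ?N" using False by (auto simp: vec_eq_iff)
    then show ?thesis using False by (simp add: cof_def)
  qed
  also have "det (replace_row ?N i (M $ j)) = - cof M i k"
  proof -
    let ?A = "replace_row M i (axis k 1)" and ?p = "Transposition.transpose i j"
    have "det (\<chi> a. ?A $ ?p a) = of_int (sign ?p) * det ?A"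
      by (rule det_permute_rows) (simp add: permutes_swap_id)
    moreover have "(\<chi> a. ?A $ ?p a) = replace_row ?N i (M $ j)"
      using False by (auto simp: vec_eq_iff Transposition.transpose_def)
    ultimately show ?thesis using False by (simp add: cof_def sign_swap_id)
  qed
  finally show ?thesis by simp
qed simp

lemma cof_scale_rows:
  fixes M :: "'a::comm_ring_1 ^ 'n ^ 'n"
  shows "cof (\<chi> i. c i *s M $ i) j k = prod c (- {j}) * cof M j k"
proof -
  let ?c = "\<lambda>i. if i = j then 1 else c i"
  have "replace_row (\<chi> i. c i *s M $ i) j (axis k 1) = (\<chi> i. ?c i *s replace_row M j (axis k 1) $ i)"
    by (auto simp: vec_eq_iff)
  then have "cof (\<chi> i. c i *s M $ i) j k = prod ?c UNIV * cof M j k"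
    by (simp add: cof_def det_rows_mul)
  also have "prod ?c UNIV = prod c (- {j})" by (rule prod.mono_neutral_cong_right) auto
  finally show ?thesis .
qed

text \<open>Row \<open>i\<close> is the member through \<open>x\<close> of the pencil of hyperplanes generated by
  \<open>a i\<close> and \<open>b i\<close>. It is zero iff \<open>a i\<close> and \<open>b i\<close> both vanish at
  \<open>x\<close>, provided they are independent.\<close>
definition pencil :: "('n \<Rightarrow> 'a::comm_ring_1 ^ 'n) \<Rightarrow> ('n \<Rightarrow> 'a ^ 'n) \<Rightarrow> 'a ^ 'n \<Rightarrow> 'a ^ 'n ^ 'n" where
  "pencil a b x = (\<chi> i. dotp (b i) x *s a i - dotp (a i) x *s b i)"

lemma pencil_kills: "dotp (pencil a b x $ i) x = 0"
  by (simp add: pencil_def dotp_simps)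

text \<open>A nonzero cofactor in row \<open>j\<close> means that the other rows are independent, so that their common
  kernel is a line.\<close>
lemma common_point_unique:
  fixes M :: "'a::field ^ 'n ^ 'n"
  assumes cof: "\<And>k. cof M j k = d * x $ k" and "d \<noteq> 0" "x \<noteq> 0"
    and x: "\<And>i. i \<noteq> j \<Longrightarrow> dotp (M $ i) x = 0"
    and z: "\<And>i. i \<noteq> j \<Longrightarrow> dotp (M $ i) z = 0"
  shows "\<exists>c. z = c *s x"
proof -
  obtain k where k: "x $ k \<noteq> 0" using \<open>x \<noteq> 0\<close> by (auto simp: vec_eq_iff)
  let ?T = "replace_row M j (axis k 1)"
  have "det ?T \<noteq> 0" using cof[of k] k \<open>d \<noteq> 0\<close> by (simp add: cof_def)
  then have "x $ k *s z - z $ k *s x = 0"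
    using x z by (intro kernel_eq_0[of ?T]) (auto simp: dotp_simps)
  then have "z = (z $ k / x $ k) *s x" using k by (simp add: vec_eq_iff field_simps)
  then show ?thesis ..
qed

text \<open>The relation between the rows is unique up to scaling, with the \<open>D j\<close> as its coefficients, as
  soon as one of the \<open>D j\<close> is nonzero.\<close>
lemma row_relation_proportional:
  fixes M :: "'a::field ^ 'n ^ 'n"
  assumes cof: "\<And>j k. cof M j k = D j * x $ k" and "x \<noteq> 0"
    and rel: "(\<Sum>l\<in>UNIV. \<mu> l *s M $ l) = 0"
  shows "\<mu> i * D j = \<mu> j * D i"
proof -
  obtain k where k: "x $ k \<noteq> 0" using \<open>x \<noteq> 0\<close> by (auto simp: vec_eq_iff)
  show ?thesis using cof_row_relation[OF rel, of i j k] k by (simp add: cof)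
qed

text \<open>The rows kill \<open>x \<noteq> 0\<close>, so they satisfy some nontrivial relation, to which the \<open>D
  j\<close> are proportional.\<close>
lemma cofactor_row_relation:
  fixes M :: "'a::field ^ 'n ^ 'n"
  assumes cof: "\<And>j k. cof M j k = D j * x $ k" and "x \<noteq> 0"
    and x: "\<And>i. dotp (M $ i) x = 0"
  shows "(\<Sum>j\<in>UNIV. D j *s M $ j) = 0"
proof -
  have "det M = 0" using x \<open>x \<noteq> 0\<close> by (rule det_eq_0_of_kernel)
  then obtain \<mu> where l: "\<mu> \<noteq> 0" "(\<Sum>i\<in>UNIV. \<mu> $ i *s M $ i) = 0" by (rule left_kernel)
  then obtain i where i: "\<mu> $ i \<noteq> 0" by (auto simp: vec_eq_iff)
  have "\<mu> $ i *s (\<Sum>j\<in>UNIV. D j *s M $ j) = D i *s (\<Sum>j\<in>UNIV. \<mu> $ j *s M $ j)"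
    unfolding vec.scale_sum_right
  proof (rule sum.cong)
    fix j
    have "\<mu> $ i * D j = \<mu> $ j * D i" using row_relation_proportional[OF cof \<open>x \<noteq> 0\<close> l(2)] .
    then show "\<mu> $ i *s (D j *s M $ j) = D i *s (\<mu> $ j *s M $ j)"
      by (simp flip: mult.assoc)
  qed simp
  then show ?thesis using l(2) i by (simp add: vec.scale_eq_0_iff)
qed

section \<open>The forms cutting out the hypersurfaces\<close>
definition mapv :: "('a \<Rightarrow> 'b) \<Rightarrow> 'a ^ 'n \<Rightarrow> 'b ^ 'n" where
  "mapv h v = (\<chi> i. h (v $ i))"

lemma mapv_nth [simp]: "mapv h v $ i = h (v $ i)"
  by (simp add: mapv_def)

lemma rhom_dotp: "rhom h \<Longrightarrow> h (dotp u v) = dotp (mapv h u) (mapv h v)"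
  by (simp add: dotp_def rhomD)

lemma rhom_cof:
  assumes "rhom h"
  shows "h (cof M j k) = cof (\<chi> i. mapv h (M $ i)) j k"
proof -
  have "(\<chi> i l. h (replace_row M j (axis k 1) $ i $ l)) = replace_row (\<chi> i. mapv h (M $ i)) j (axis k 1)"
    using assms by (auto simp: vec_eq_iff axis_def rhomD)
  then show ?thesis by (simp add: cof_def rhom_det[OF assms])
qed

lemma rhom_pencil:
  "rhom h \<Longrightarrow> (\<chi> i. mapv h (pencil a b x $ i)) = pencil (mapv h \<circ> a) (mapv h \<circ> b) (mapv h x)"
  by (simp add: vec_eq_iff pencil_def rhomD rhom_dotp)

definition mval :: "('n, 'k::comm_ring_1) mpoly \<Rightarrow> 'k ^ 'n \<Rightarrow> 'k" where
  "mval p x = msubst id (($) x) p"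

lemma rhom_mval: "rhom (\<lambda>p. mval p x)"
  unfolding mval_def by (rule rhom_eval)

lemmas mval_simps = rhomD[OF rhom_mval]
lemmas geval_simps = rhomD[OF rhom_geom_eval]

lemma mval_mvar [simp]: "mval (mvar i) x = x $ i"
  and mval_mconst [simp]: "mval (mconst c) x = c"
  by (simp_all add: mval_def msubst_mvar[OF rhom_id] msubst_mconst[OF rhom_id])

lemma geval_mvar [simp]: "geom_eval (mvar i) x = x $ i"
  and geval_mconst [simp]: "geom_eval (mconst c) x = to_ac c"
  by (simp_all add: geom_eval_def msubst_mvar[OF rhom_to_ac] msubst_mconst[OF rhom_to_ac])

lemma mval_eqI:
  fixes p q :: "('n::finite, 'k::field_char_0) mpoly"
  assumes "\<And>x. mval p x = mval q x"
  shows "p = q"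
proof (rule mpoly_eqI)
  fix y :: "'n \<Rightarrow> 'k"
  show "msubst id y p = msubst id y q"
    using assms[of "\<chi> i. y i"] by (simp add: mval_def vec_lambda_inverse)
qed

lemma mval_eq_0I:
  fixes p :: "('n::finite, 'k::field_char_0) mpoly"
  assumes "\<And>x. mval p x = 0"
  shows "p = 0"
  by (rule mval_eqI) (simp add: assms mval_simps)

lemma geom_eval_mapv: "geom_eval p (mapv to_ac y) = to_ac (mval p y)"
  using geom_eval_to_ac[of p "($) y"] by (simp add: mval_def mapv_def)

lemma mval_scale: "is_form d p \<Longrightarrow> mval p (c *s x) = c ^ d * mval p x"
  using msubst_scale[OF _ rhom_id, of d p c "($) x"]
  by (simp add: mval_def vector_scalar_mult_def vec_lambda_inverse)

lemma mval_form_0: "is_form d p \<Longrightarrow> d > 0 \<Longrightarrow> mval p 0 = 0"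
  using mval_scale[of d p 0 0] by (simp add: zero_power)

lemma geval_form_0: "is_form d p \<Longrightarrow> d > 0 \<Longrightarrow> geom_eval p 0 = 0"
  using geom_eval_scale[of d p 0 0] by (simp add: zero_power)

lemma mval_ratmap_comp: "mval (ratmap_comp g f i) x = mval (g i) (\<chi> l. mval (f l) x)"
proof -
  have "(\<lambda>q. mval q x) \<circ> mconst = id" by (simp add: fun_eq_iff)
  moreover have "mval (msubst mconst f (g i)) x = msubst ((\<lambda>q. mval q x) \<circ> mconst) ((\<lambda>q. mval q x) \<circ> f) (g i)"
    by (rule rhom_msubst_comp[OF rhom_mval])
  ultimately show ?thesis
    by (simp add: ratmap_comp_def mval_def[of "g i"] vec_lambda_inverse comp_def)
qed

definition linear_form :: "'k::comm_ring_1 ^ 'n \<Rightarrow> ('n, 'k) mpoly" where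
  "linear_form u = (\<Sum>k\<in>UNIV. mconst (u $ k) * mvar k)"

lemma mval_linear_form [simp]: "mval (linear_form u) x = dotp u x"
  by (simp add: linear_form_def dotp_def mval_simps)

lemma geval_linear_form [simp]: "geom_eval (linear_form u) x = dotp (mapv to_ac u) x"
  by (simp add: linear_form_def dotp_def geval_simps)

lemma is_form_linear_form: "is_form 1 (linear_form u)"
  unfolding linear_form_def by (intro is_form_sum is_form_mconst_mult is_form_mvar)

text \<open>The matrix at the generic point. Identities between its cofactors specialise to points over the ground
  field and over its algebraic closure alike.\<close>
definition poly_pencil :: "('n \<Rightarrow> 'k::comm_ring_1 ^ 'n) \<Rightarrow> ('n \<Rightarrow> 'k ^ 'n) \<Rightarrow> ('n, 'k) mpoly ^ 'n ^ 'n" where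
  "poly_pencil a b = pencil (mapv mconst \<circ> a) (mapv mconst \<circ> b) (\<chi> k. mvar k)"

lemma mval_cof_poly_pencil:
  fixes a b :: "'n::finite \<Rightarrow> 'k::field ^ 'n"
  shows "mval (cof (poly_pencil a b) j k) x = cof (pencil a b x) j k"
proof -
  have 1: "mapv (\<lambda>p. mval p x) (\<chi> k. mvar k) = x" by (simp add: vec_eq_iff)
  have 2: "mapv (\<lambda>p. mval p x) \<circ> (mapv mconst \<circ> a) = a" for a :: "'n \<Rightarrow> 'k ^ 'n"
    by (simp add: fun_eq_iff vec_eq_iff)
  show ?thesis
    using rhom_cof[OF rhom_mval, of "poly_pencil a b" j k x] rhom_pencil[OF rhom_mval, of x "mapv mconst \<circ> a" "mapv mconst \<circ> b" "\<chi> k. mvar k"]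
    by (simp add: poly_pencil_def 1 2)
qed

lemma geval_cof_poly_pencil:
  fixes a b :: "'n::finite \<Rightarrow> 'k::field ^ 'n"
  shows "geom_eval (cof (poly_pencil a b) j k) x = cof (pencil (mapv to_ac \<circ> a) (mapv to_ac \<circ> b) x) j k"
proof -
  have 1: "mapv (\<lambda>p. geom_eval p x) (\<chi> k. mvar k) = x" by (simp add: vec_eq_iff)
  have 2: "mapv (\<lambda>p. geom_eval p x) \<circ> (mapv mconst \<circ> a) = mapv to_ac \<circ> a" for a :: "'n \<Rightarrow> 'k ^ 'n"
    by (simp add: fun_eq_iff vec_eq_iff)
  show ?thesis
    using rhom_cof[OF rhom_geom_eval, of "poly_pencil a b" j k x] rhom_pencil[OF rhom_geom_eval, of x "mapv mconst \<circ> a" "mapv mconst \<circ> b" "\<chi> k. mvar k"]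
    by (simp add: poly_pencil_def 1 2)
qed

lemma is_form_cof:
  fixes M :: "('i, 'k::comm_ring_1) mpoly ^ 'n ^ 'n"
  assumes "\<And>i k. is_form d (M $ i $ k)"
  shows "is_form ((CARD('n) - 1) * d) (cof M j k)"
proof -
  have "is_form (\<Sum>i\<in>UNIV. if i = j then 0 else d) (cof M j k)"
    unfolding cof_def using assms by (intro is_form_det) (auto simp: axis_def is_form_1 is_form_0)
  moreover have "(\<Sum>i\<in>UNIV. if i = j then 0 else d) = (\<Sum>i\<in>UNIV - {j}. d)"
    by (rule sum.mono_neutral_cong_right) auto
  ultimately show ?thesis by (simp add: card_Diff_singleton)
qed

text \<open>The rows other than \<open>j\<close> kill \<open>x\<close>, so the vector of cofactors of row
  \<open>j\<close> is proportional to \<open>x\<close>. In particular the \<open>j\<close>-th cofactor vanishes where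
  \<open>x\<^sub>j = 0\<close>, hence is divisible by \<open>x\<^sub>j\<close>, and the quotient serves for all other
  cofactors too.\<close>
lemma ex_pencil_form:
  fixes a b :: "'n::finite \<Rightarrow> 'k::field_char_0 ^ 'n"
  assumes n: "CARD('n) \<ge> 2"
  shows "\<exists>q. is_form (CARD('n) - 2) q \<and> (\<forall>k. cof (poly_pencil a b) j k = mvar k * q)"
proof -
  let ?P = "poly_pencil a b"
  have "is_form 1 (?P $ i $ k)" for i k
    by (auto simp: poly_pencil_def pencil_def dotp_def intro!: is_form_diff is_form_sum
        is_form_mconst_mult is_form_mvar[unfolded One_nat_def] simp: mult.commute[of _ "mconst _"])
  then have form: "is_form (CARD('n) - 1) (cof ?P j k)" for k
    using is_form_cof[of 1 ?P j k] by simp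
  have minors: "x $ l * cof (pencil a b x) j k = x $ k * cof (pencil a b x) j l" for x k l
    by (rule cof_proportional) (rule pencil_kills)
  have "msubst id y (cof ?P j j) = 0" if y: "y j = 0" for y
  proof -
    let ?x = "\<chi> i. y i"
    have "mval (cof ?P j j) ?x = 0"
    proof (cases "?x = 0")
      case True
      then show ?thesis using mval_form_0[OF form] n by simp
    next
      case False
      then obtain l where "?x $ l \<noteq> 0" by (auto simp: vec_eq_iff)
      then show ?thesis using minors[of ?x l j] y by (simp add: mval_cof_poly_pencil)
    qed
    then show ?thesis by (simp add: mval_def vec_lambda_inverse)
  qed
  moreover have "CARD('n) - 1 = Suc (CARD('n) - 2)" using n by simp
  ultimately obtain q where q: "is_form (CARD('n) - 2) q" "cof ?P j j = mvar j * q"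
    using form_divisible_by_mvar[of "CARD('n) - 2" "cof ?P j j" j] form[of j] by metis
  have "cof ?P j k = mvar k * q" for k
  proof -
    have "mvar j * cof ?P j k = mvar k * cof ?P j j"
      by (rule mval_eqI) (simp add: mval_simps mval_cof_poly_pencil minors)
    then have "mvar j * (cof ?P j k - mvar k * q) = 0" by (simp add: q algebra_simps)
    moreover have "mvar j \<noteq> (0 :: ('n, 'k) mpoly)"
      by (metis mvar_def lookup_single_eq lookup_zero zero_neq_one)
    ultimately show ?thesis using mpoly_mult_eq_0 by fastforce
  qed
  then show ?thesis using q by blast
qed

definition pencil_form :: "('n \<Rightarrow> 'k::field ^ 'n) \<Rightarrow> ('n \<Rightarrow> 'k ^ 'n) \<Rightarrow> 'n \<Rightarrow> ('n, 'k) mpoly" where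
  "pencil_form a b j = (SOME q. is_form (CARD('n) - 2) q \<and> (\<forall>k. cof (poly_pencil a b) j k = mvar k * q))"

section \<open>Spans and independence of finite families of polynomials\<close>
lemma span_range_iff:
  fixes f :: "'n::finite \<Rightarrow> ('i, 'k::field) mpoly"
  shows "p \<in> mpoly.span (range f) \<longleftrightarrow> (\<exists>c. p = (\<Sum>i\<in>UNIV. mconst (c i) * f i))"
proof
  assume "p \<in> mpoly.span (range f)"
  then show "\<exists>c. p = (\<Sum>i\<in>UNIV. mconst (c i) * f i)"
  proof (induction rule: mpoly.span_induct_alt)
    case base
    show ?case by (rule exI[where x = "\<lambda>_. 0"]) (simp add: rhomD[OF rhom_mconst])
  next
    case (step t x y)
    obtain i where i: "x = f i" using step(1) by blast
    obtain c where c: "y = (\<Sum>i\<in>UNIV. mconst (c i) * f i)" using step(2) by blast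
    have "(\<Sum>l\<in>UNIV. mconst ((if l = i then t else 0) + c l) * f l) = mconst t * x + y"
      by (simp add: rhomD[OF rhom_mconst] distrib_right sum.distrib c i if_distrib[of mconst]
          if_distrib[of "\<lambda>z. z * _"] cong: if_cong)
    then show ?case by (intro exI[where x = "\<lambda>l. (if l = i then t else 0) + c l"]) simp
  qed
next
  assume "\<exists>c. p = (\<Sum>i\<in>UNIV. mconst (c i) * f i)"
  then show "p \<in> mpoly.span (range f)"
    by (elim exE) (simp only:, intro mpoly.span_sum mpoly.span_scale mpoly.span_base rangeI)
qed

lemma independent_rangeD:
  fixes f :: "'n::finite \<Rightarrow> ('i, 'k::field) mpoly"
  assumes "inj f" "mpoly.independent (range f)" "(\<Sum>i\<in>UNIV. mconst (c i) * f i) = 0"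
  shows "c i = 0"
proof -
  have "(\<Sum>v\<in>range f. mconst (c (inv_into UNIV f v)) * v) = (\<Sum>i\<in>UNIV. mconst (c i) * f i)"
    using assms(1) by (simp add: sum.reindex inv_f_f)
  then have "(c \<circ> inv_into UNIV f) (f i) = 0"
    using assms by (intro mpoly.independentD[OF assms(2), where t = "range f"]) auto
  then show ?thesis using assms(1) by simp
qed

lemma independent_rangeI:
  fixes f :: "'n::finite \<Rightarrow> ('i, 'k::field) mpoly"
  assumes "\<And>c i. (\<Sum>i\<in>UNIV. mconst (c i) * f i) = 0 \<Longrightarrow> c i = 0"
  shows "inj f" "mpoly.independent (range f)"
proof -
  show inj: "inj f"
  proof (rule injI, rule ccontr)
    fix i j assume ij: "f i = f j" "i \<noteq> j"
    have "(\<Sum>l\<in>UNIV. mconst ((if l = i then 1 else 0) - (if l = j then 1 else 0)) * f l) = 0"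
      using ij(1) by (simp add: rhomD[OF rhom_mconst] left_diff_distrib sum_subtractf if_distrib[of mconst]
          if_distrib[of "\<lambda>z. z * _"] cong: if_cong)
    from assms[OF this, of i] ij(2) show False by simp
  qed
  show "mpoly.independent (range f)"
  proof (rule mpoly.independent_if_scalars_zero)
    fix c x assume *: "(\<Sum>x\<in>range f. mconst (c x) * x) = 0" "x \<in> range f"
    then have "(\<Sum>i\<in>UNIV. mconst (c (f i)) * f i) = 0" using inj by (simp add: sum.reindex)
    then show "c x = 0" using assms *(2) by auto
  qed simp
qed

section \<open>Subspaces in general position\<close>

text \<open>The \<open>e k\<close> are the vertices of the coordinate simplex whose facets are the zero sets of the
  \<open>a i\<close>.\<close>
locale general_position =
  fixes a b e :: "'n::finite \<Rightarrow> 'k::field_char_0 ^ 'n"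
  assumes card_ge_3: "CARD('n) \<ge> 3"
    and dual: "dotp (a i) (e k) = (if i = k then 1 else 0)"
    and expand: "x = (\<Sum>k\<in>UNIV. dotp (a k) x *s e k)"
    and generic: "generic_matrix (\<lambda>i k. dotp (b i) (e k))"
begin

definition W :: "'n \<Rightarrow> ('k ^ 'n) set" where
  "W i = {v. dotp (a i) v = 0 \<and> dotp (b i) v = 0}"

lemma ex_other: "\<exists>j :: 'n. j \<noteq> i"
proof (rule ccontr)
  assume "\<not> ?thesis"
  then have "(UNIV :: 'n set) = {i}" by auto
  then have "CARD('n) = 1" by (metis card_1_singleton_iff One_nat_def)
  then show False using card_ge_3 by simp
qed

text \<open>The vectors \<open>r\<close> and \<open>s\<close> in the proof satisfy \<open>a\<^sub>i(r) = 0\<close>,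
  \<open>b\<^sub>i(r) = 1\<close> and \<open>a\<^sub>i(s) = 1\<close>, \<open>b\<^sub>i(s) = 0\<close>, so together
  with \<open>W i\<close> they span the whole space.\<close>
lemma W_codim2: "W \<in> codim2_tuples"
proof -
  have sub: "vec.subspace (W i)" for i by (auto simp: W_def vec.subspace_def dotp_simps)
  have "vec.dim (W i) + 2 = CARD('n)" for i
  proof -
    obtain j where j: "j \<noteq> i" using ex_other by blast
    have Bij: "dotp (b i) (e j) \<noteq> 0" using generic j by (simp add: generic_matrix_def)
    define r where "r = inverse (dotp (b i) (e j)) *s e j"
    define s where "s = e i - dotp (b i) (e i) *s r"
    have r: "dotp (a i) r = 0" "dotp (b i) r = 1" using Bij j by (auto simp: r_def dotp_simps dual)
    have s: "dotp (a i) s = 1" "dotp (b i) s = 0" by (auto simp: s_def dotp_simps dual r)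
    have hyperplane: "vec.subspace {x. dotp u x = 0}" for u :: "'k ^ 'n"
      by (simp add: vec.subspace_def dotp_simps)
    have "vec.span (W i) \<subseteq> {x. dotp (a i) x = 0}"
      by (rule vec.span_minimal[OF _ hyperplane]) (auto simp: W_def)
    moreover have "vec.span (insert s (W i)) \<subseteq> {x. dotp (b i) x = 0}"
      by (rule vec.span_minimal[OF _ hyperplane]) (auto simp: W_def s)
    ultimately have "s \<notin> vec.span (W i)" "r \<notin> vec.span (insert s (W i))" using s r by auto
    then have "vec.dim (insert r (insert s (W i))) = vec.dim (W i) + 2" by (simp add: vec.dim_insert)
    moreover have "x \<in> vec.span (insert r (insert s (W i)))" for x
    proof -
      let ?w = "x - dotp (a i) x *s s - dotp (b i) x *s r"
      have "?w \<in> W i" by (simp add: W_def dotp_simps r s)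
      then have "?w + dotp (a i) x *s s + dotp (b i) x *s r \<in> vec.span (insert r (insert s (W i)))"
        by (intro vec.span_add vec.span_scale) (auto intro: vec.span_base)
      then show ?thesis by simp
    qed
    then have "vec.span (insert r (insert s (W i))) = UNIV" by blast
    then have "vec.dim (insert r (insert s (W i))) = CARD('n)"
      by (metis vec.dim_span vec_dim_card)
    ultimately show ?thesis by simp
  qed
  then show ?thesis by (simp add: codim2_tuples_def sub)
qed

abbreviation aK where "aK \<equiv> mapv to_ac \<circ> a"
abbreviation bK where "bK \<equiv> mapv to_ac \<circ> b"
abbreviation Q where "Q \<equiv> pencil_form a b"

lemma form_Q: "is_form (CARD('n) - 2) (Q j)"
  and cof_poly: "cof (poly_pencil a b) j k = mvar k * Q j"
proof -
  have "CARD('n) \<ge> 2" using card_ge_3 by simp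
  from someI_ex[OF ex_pencil_form[OF this, of a b j], folded pencil_form_def]
  show "is_form (CARD('n) - 2) (Q j)" "cof (poly_pencil a b) j k = mvar k * Q j" by blast+
qed

lemma cof_pencil_mval: "cof (pencil a b x) j k = mval (Q j) x * x $ k"
  using mval_cof_poly_pencil[of a b j k x] by (simp add: cof_poly mval_simps mult.commute)

lemma cof_pencil_geom_eval: "cof (pencil aK bK x) j k = geom_eval (Q j) x * x $ k"
  using geval_cof_poly_pencil[of a b j k x] by (simp add: cof_poly geval_simps mult.commute)

lemma geom_points_W:
  assumes "x \<in> geom_points (W i)"
  shows "dotp (aK i) x = 0" "dotp (bK i) x = 0"
proof -
  let ?S = "{x. dotp (aK i) x = 0 \<and> dotp (bK i) x = 0}"
  have "vec.subspace ?S" by (auto simp: vec.subspace_def dotp_simps)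
  moreover have "(\<lambda>v. \<chi> l. to_ac (v $ l)) ` W i \<subseteq> ?S"
  proof (rule image_subsetI)
    fix v assume "v \<in> W i"
    then have "to_ac (dotp (a i) v) = 0" "to_ac (dotp (b i) v) = 0" by (simp_all add: W_def)
    then show "(\<chi> l. to_ac (v $ l)) \<in> ?S" by (simp add: rhom_dotp[OF rhom_to_ac] flip: mapv_def)
  qed
  ultimately have "geom_points (W i) \<subseteq> ?S" unfolding geom_points_def by (rule vec.span_minimal[rotated])
  then show "dotp (aK i) x = 0" "dotp (bK i) x = 0" using assms by auto
qed

text \<open>Row \<open>i\<close> of the matrix is zero at such a point, and it occurs in every cofactor of row
  \<open>j\<close>.\<close>
lemma Q_vanishes:
  assumes "dotp (aK i) x = 0" "dotp (bK i) x = 0" "i \<noteq> j"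
  shows "geom_eval (Q j) x = 0"
proof (cases "x = 0")
  case True
  then show ?thesis using geval_form_0[OF form_Q] card_ge_3 by simp
next
  case False
  then obtain k where k: "x $ k \<noteq> 0" by (auto simp: vec_eq_iff)
  have "pencil aK bK x $ i = 0" using assms by (simp add: pencil_def)
  then have "cof (pencil aK bK x) j k = 0" using assms(3) by (rule cof_zero_row)
  then show ?thesis using k by (simp add: cof_pencil_geom_eval)
qed

lemma Q_vanishing: "Q j \<in> forms_vanishing (CARD('n) - 2) (- {j}) W"
proof -
  have "geom_eval (Q j) x = 0" if "i \<in> - {j}" "x \<in> geom_points (W i)" for i x
    using that by (intro Q_vanishes[OF geom_points_W]) auto
  then show ?thesis by (simp add: forms_vanishing_def form_Q)
qed

lemma vanishing_on_W:
  assumes "p \<in> forms_vanishing d I W" "i \<in> I" "v \<in> W i"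
  shows "mval p v = 0"
proof -
  have "mapv to_ac v \<in> geom_points (W i)"
    unfolding geom_points_def mapv_def by (rule vec.span_base) (use assms in auto)
  then have "geom_eval p (mapv to_ac v) = 0" using assms by (auto simp: forms_vanishing_def)
  then show ?thesis by (simp add: geom_eval_mapv)
qed

text \<open>At the vertex \<open>e j\<close> the rows with \<open>i \<noteq> j\<close> are nonzero multiples of the
  \<open>a i\<close>. With \<open>a j\<close> as row \<open>j\<close> the matrix becomes invertible, and its
  determinant is \<open>Q\<^sub>j(e\<^sub>j) a\<^sub>j(e\<^sub>j) = Q\<^sub>j(e\<^sub>j)\<close>.\<close>
lemma Q_vertex: "mval (Q j) (e j) \<noteq> 0"
proof -
  let ?M = "replace_row (pencil a b (e j)) j (a j)"
  have "det ?M = (\<Sum>k\<in>UNIV. a j $ k * (mval (Q j) (e j) * e j $ k))"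
    by (simp add: det_replace_row cof_pencil_mval)
  also have "\<dots> = mval (Q j) (e j) * dotp (a j) (e j)"
    by (simp add: dotp_def sum_distrib_left mult_ac)
  finally have "det ?M = mval (Q j) (e j)" by (simp add: dual)
  moreover have "det ?M \<noteq> 0"
  proof (rule det_neq_0_of_trivial_kernel)
    fix z assume z: "\<And>i. dotp (?M $ i) z = 0"
    have "dotp (a i) z = 0" for i
    proof (cases "i = j")
      case True
      then show ?thesis using z[of j] by simp
    next
      case False
      then have "dotp (b i) (e j) \<noteq> 0" using generic by (simp add: generic_matrix_def)
      then show ?thesis using z[of i] False by (simp add: pencil_def dual dotp_simps)
    qed
    then show "z = 0" using expand[of z] by simp
  qed
  ultimately show ?thesis by simp
qed

text \<open>The instances are \<open>I = UNIV\<close> and \<open>d = n\<close>, where the value at every vertex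
  enters, and \<open>I = - {j}\<close> and \<open>d = n - 1\<close>, where only the value at the vertex \<open>e
  j\<close> does.\<close>
lemma form_eq_0_of_vertices:
  assumes p: "p \<in> forms_vanishing d I W" and I: "d < card I"
    and base: "\<And>k. - I \<subseteq> {k} \<Longrightarrow> mval p (e k) = 0" and "d > 0"
  shows "p = 0"
proof (rule mval_eq_0I)
  fix x
  define v where "v = (\<lambda>s. \<Sum>k\<in>UNIV. s k *s e k)"
  have form: "is_form d p" using p by (simp add: forms_vanishing_def)
  have av: "dotp (a i) (v s) = s i" for i s
    by (simp add: v_def dotp_sum dotp_simps dual if_distrib[of "\<lambda>z. _ * z"] cong: if_cong)
  have bv: "dotp (b i) (v s) = (\<Sum>k\<in>UNIV. dotp (b i) (e k) * s k)" for i s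
    by (simp add: v_def dotp_sum dotp_simps mult.commute)
  have "mval p (v (\<lambda>k. dotp (a k) x)) = 0"
  proof (rule form_determined_at_vertices[where f = "\<lambda>s. mval p (v s)" and d = d and I = I and T = UNIV])
    fix s r :: "'n \<Rightarrow> 'k"
    have "v (\<lambda>k. s k + t * r k) = (\<chi> i. v s $ i + t * v r $ i)" for t
      by (simp add: v_def vec_eq_iff sum.distrib sum_distrib_left algebra_simps)
    then show "\<exists>q. Polynomial.degree q \<le> d \<and> (\<forall>t. poly q t = mval p (v (\<lambda>k. s k + t * r k)))"
      using form_along_line[OF form, of "($) (v s)" "($) (v r)"] by (simp add: mval_def vec_lambda_inverse)
  next
    show "generic_matrix (\<lambda>i k. dotp (b i) (e k))" by (rule generic)
  next
    fix i s assume "i \<in> I" "s i = 0" "(\<Sum>k\<in>UNIV. dotp (b i) (e k) * s k) = 0"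
    then show "mval p (v s) = 0" using vanishing_on_W[OF p, of i "v s"] by (simp add: W_def av bv)
  next
    fix k and s :: "'n \<Rightarrow> 'k" assume k: "- I \<subseteq> {k}" and s: "\<forall>i. i \<noteq> k \<longrightarrow> s i = 0"
    have "v s = (\<Sum>i\<in>UNIV. if i = k then s k *s e k else 0)"
      unfolding v_def using s by (intro sum.cong) auto
    then have "v s = s k *s e k" by simp
    then show "mval p (v s) = 0" using base[OF k] by (simp add: mval_scale[OF form])
  qed (use I in auto)
  then show "mval p x = 0" using expand[of x] by (simp add: v_def)
qed

lemma Q_neq_0: "Q j \<noteq> 0"
  using Q_vertex[of j] by (auto simp: mval_simps)

lemma forms_vanishing_diff:
  assumes "p \<in> forms_vanishing d I W" "q \<in> forms_vanishing d I W"
  shows "p - mconst c * q \<in> forms_vanishing d I W"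
  using assms by (auto simp: forms_vanishing_def geval_simps intro!: is_form_diff is_form_mconst_mult)

text \<open>A form of degree \<open>n - 1\<close> through the subspaces other than \<open>W j\<close> is determined by
  its value at \<open>e j\<close>, and that of \<open>Q j\<close> is not zero.\<close>
lemma Q_equation_Q: "Q_equation W j (Q j)"
  unfolding Q_equation_def
proof (intro conjI ballI impI)
  fix p assume p: "p \<in> forms_vanishing (CARD('n) - 2) (- {j}) W"
  let ?c = "mval p (e j) / mval (Q j) (e j)"
  have "p - mconst ?c * Q j = 0"
  proof (rule form_eq_0_of_vertices)
    show "p - mconst ?c * Q j \<in> forms_vanishing (CARD('n) - 2) (- {j}) W"
      using p Q_vanishing by (rule forms_vanishing_diff)
    show "CARD('n) - 2 < card (- {j})" using card_ge_3 by (simp add: Compl_eq_Diff_UNIV card_Diff_singleton)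
    show "mval (p - mconst ?c * Q j) (e k) = 0" if "- (- {j}) \<subseteq> {k}" for k
      using that Q_vertex by (simp add: mval_simps)
  qed (use card_ge_3 in auto)
  then show "\<exists>c. p = mconst c * Q j" by (intro exI[of _ ?c]) simp
qed (auto simp: Q_vanishing Q_neq_0)

definition U where "U i = Q i * linear_form (a i)"
definition V where "V i = Q i * linear_form (b i)"

lemma lin_sys_UV: "U i \<in> lin_sys W" "V i \<in> lin_sys W"
proof -
  have deg: "CARD('n) - 2 + 1 = CARD('n) - 1" using card_ge_3 by simp
  have "is_form (CARD('n) - 1) (U i)" "is_form (CARD('n) - 1) (V i)"
    unfolding U_def V_def using is_form_mult[OF form_Q is_form_linear_form] deg by metis+
  moreover have "geom_eval (U i) x = 0 \<and> geom_eval (V i) x = 0" if "x \<in> geom_points (W l)" for l x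
    using geom_points_W[OF that] Q_vanishes[of l x i] by (cases "l = i") (auto simp: U_def V_def geval_simps)
  ultimately show "U i \<in> lin_sys W" "V i \<in> lin_sys W" by (auto simp: lin_sys_def forms_vanishing_def)
qed

lemma U_vertex: "mval (U i) (e k) = (if i = k then mval (Q i) (e i) else 0)"
  by (simp add: U_def mval_simps dual)

text \<open>Both sides agree at all vertices, because \<open>U i\<close> vanishes at every vertex except \<open>e
  i\<close>.\<close>
lemma lin_sys_expand:
  assumes "p \<in> lin_sys W"
  shows "p = (\<Sum>i\<in>UNIV. mconst (mval p (e i) / mval (Q i) (e i)) * U i)"
proof -
  let ?s = "\<Sum>i\<in>UNIV. mconst (mval p (e i) / mval (Q i) (e i)) * U i"
  have "p - ?s = 0"
  proof (rule form_eq_0_of_vertices)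
    show "p - ?s \<in> forms_vanishing (CARD('n) - 1) UNIV W"
      using assms lin_sys_UV by (auto simp: lin_sys_def forms_vanishing_def geval_simps
          intro!: is_form_diff is_form_sum is_form_mconst_mult sum.neutral)
    show "CARD('n) - 1 < card (UNIV :: 'n set)" using card_ge_3 by simp
    show "mval (p - ?s) (e k) = 0" for k
      using Q_vertex[of k] by (simp add: mval_simps U_vertex if_distrib[of "\<lambda>z. _ * z"] cong: if_cong)
  qed (use card_ge_3 in auto)
  then show ?thesis by simp
qed

lemma U_basis:
  shows U_inj: "inj U" and U_independent: "mpoly.independent (range U)" and U_span: "mpoly.span (range U) = lin_sys W"
proof -
  have 1: "c i = 0" if c: "(\<Sum>i\<in>UNIV. mconst (c i) * U i) = 0" for c i
  proof -
    have "mval (\<Sum>i\<in>UNIV. mconst (c i) * U i) (e i) = c i * mval (Q i) (e i)"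
      by (simp add: mval_simps U_vertex if_distrib[of "\<lambda>z. _ * z"] cong: if_cong)
    then show ?thesis using c Q_vertex[of i] by (simp add: mval_simps)
  qed
  show "inj U"
  proof (rule independent_rangeI(1))
    show "c i = 0" if "(\<Sum>i\<in>UNIV. mconst (c i) * U i) = 0" for c i using 1[of c i] that .
  qed
  show "mpoly.independent (range U)"
  proof (rule independent_rangeI(2))
    show "c i = 0" if "(\<Sum>i\<in>UNIV. mconst (c i) * U i) = 0" for c i using 1[of c i] that .
  qed
  show "mpoly.span (range U) = lin_sys W"
  proof
    show "lin_sys W \<subseteq> mpoly.span (range U)" unfolding subset_iff span_range_iff
      by (intro allI impI) (rule exI, erule lin_sys_expand)
    show "mpoly.span (range U) \<subseteq> lin_sys W"
    proof (rule mpoly.span_minimal)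
      show "mpoly.subspace (lin_sys W)"
        by (auto simp: mpoly.subspace_def lin_sys_def forms_vanishing_def geval_simps is_form_0 is_form_add is_form_mconst_mult)
    qed (use lin_sys_UV in auto)
  qed
qed

lemma dim_lin_sys: "mpoly.dim (lin_sys W) = CARD('n)"
proof (rule mpoly.dim_unique[of "range U"])
  show "range U \<subseteq> lin_sys W" using lin_sys_UV by auto
  show "lin_sys W \<subseteq> mpoly.span (range U)" by (simp add: U_span)
  show "mpoly.independent (range U)" by (rule U_independent)
  show "card (range U) = CARD('n)" using card_image[OF U_inj] by simp
qed

end

section \<open>Injectivity away from the hypersurfaces\<close>

text \<open>The coefficient vectors \<open>P i\<close> and \<open>R i\<close> recover \<open>Q\<^sub>i
  a\<^sub>i\<close> and \<open>Q\<^sub>i b\<^sub>i\<close> from the values of \<open>v\<close>; they are what both the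
  injectivity and the construction of the inverse use. The matrix with rows \<open>C i\<close> is the inverse of the
  one with rows \<open>P i\<close>.\<close>
locale linear_system_basis = general_position a b e for a b e :: "'n::finite \<Rightarrow> 'k::field_char_0 ^ 'n" +
  fixes v :: "'n \<Rightarrow> ('n, 'k) mpoly" and C P R :: "'n \<Rightarrow> 'k ^ 'n"
  assumes basis: "lin_sys_basis W v"
    and v_U: "v i = (\<Sum>l\<in>UNIV. mconst (C i $ l) * U l)"
    and U_v: "U i = (\<Sum>l\<in>UNIV. mconst (P i $ l) * v l)"
    and V_v: "V i = (\<Sum>l\<in>UNIV. mconst (R i $ l) * v l)"
begin

lemma v_independent: "(\<Sum>l\<in>UNIV. mconst (c l) * v l) = 0 \<Longrightarrow> c i = 0"
  using basis independent_rangeD unfolding lin_sys_basis_def by blast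

lemma form_v: "is_form (CARD('n) - 1) (v i)"
proof -
  have "v i \<in> mpoly.span (range v)" by (rule mpoly.span_base) simp
  then show ?thesis using basis by (simp add: lin_sys_basis_def lin_sys_def forms_vanishing_def)
qed

lemma v_neq_0: "v i \<noteq> 0"
proof
  assume "v i = 0"
  then have "(\<Sum>l\<in>UNIV. mconst (if l = i then 1 else 0) * v l) = 0"
    by (intro sum.neutral) (auto simp: rhomD[OF rhom_mconst])
  from v_independent[OF this, of i] show False by simp
qed

definition vK :: "'k alg_closure ^ 'n \<Rightarrow> 'k alg_closure ^ 'n" where
  "vK x = (\<chi> i. geom_eval (v i) x)"

lemma UV_vK:
  "geom_eval (Q i) x * dotp (aK i) x = dotp (mapv to_ac (P i)) (vK x)"
  "geom_eval (Q i) x * dotp (bK i) x = dotp (mapv to_ac (R i)) (vK x)"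
proof -
  have "geom_eval (U i) x = dotp (mapv to_ac (P i)) (vK x)" "geom_eval (V i) x = dotp (mapv to_ac (R i)) (vK x)"
    unfolding U_v V_v by (simp_all add: geval_simps dotp_def vK_def)
  then show "geom_eval (Q i) x * dotp (aK i) x = dotp (mapv to_ac (P i)) (vK x)"
    "geom_eval (Q i) x * dotp (bK i) x = dotp (mapv to_ac (R i)) (vK x)"
    by (simp_all add: U_def V_def geval_simps)
qed

text \<open>Where \<open>a i\<close> and \<open>b i\<close> both vanish, so does every \<open>Q j\<close> with
  \<open>j \<noteq> i\<close>.\<close>
lemma off_base_locus:
  assumes "\<And>j. geom_eval (Q j) x \<noteq> 0"
  shows "dotp (aK i) x \<noteq> 0 \<or> dotp (bK i) x \<noteq> 0"
  using Q_vanishes[of i x] assms ex_other[of i] by metis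

lemma vK_neq_0:
  assumes "\<And>j. geom_eval (Q j) x \<noteq> 0"
  shows "vK x \<noteq> 0"
proof
  assume 0: "vK x = 0"
  then have "dotp (aK i) x = 0 \<and> dotp (bK i) x = 0" for i
    using UV_vK[of i x] assms[of i] by (simp add: dotp_simps)
  then show False using off_base_locus[OF assms] by blast
qed

text \<open>The two images give proportional values of \<open>Q\<^sub>i a\<^sub>i\<close> and \<open>Q\<^sub>i
  b\<^sub>i\<close>, so \<open>x'\<close> lies on each of the hyperplanes spanned by \<open>x\<close> and \<open>W
  i\<close>. As \<open>Q\<^sub>j(x) \<noteq> 0\<close>, these meet in \<open>x\<close> only.\<close>
lemma vK_injective:
  assumes Qx: "\<And>j. geom_eval (Q j) x \<noteq> 0" and Qx': "\<And>j. geom_eval (Q j) x' \<noteq> 0"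
    and "x \<noteq> 0" and eq: "vK x' = c *s vK x"
  shows "\<exists>t. x' = t *s x"
proof (rule common_point_unique)
  fix i
  have "geom_eval (Q i) x' * dotp (aK i) x' = c * (geom_eval (Q i) x * dotp (aK i) x)"
    "geom_eval (Q i) x' * dotp (bK i) x' = c * (geom_eval (Q i) x * dotp (bK i) x)"
    unfolding UV_vK eq dotp_simps by simp_all
  then have "geom_eval (Q i) x' * dotp (pencil aK bK x $ i) x' =
    dotp (bK i) x * (c * (geom_eval (Q i) x * dotp (aK i) x)) - dotp (aK i) x * (c * (geom_eval (Q i) x * dotp (bK i) x))"
    by (simp add: pencil_def dotp_simps right_diff_distrib mult.left_commute[of "geom_eval (Q i) x'"])
  then show "dotp (pencil aK bK x $ i) x' = 0" using Qx'[of i] by simp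
qed (use assms cof_pencil_geom_eval pencil_kills in auto)

lemma ratmap_apply_span: "ratmap_apply v (vec.span {x}) = vec.span {vK x}"
proof -
  have "vK ` vec.span {x} \<subseteq> vec.span {vK x}"
  proof (rule image_subsetI)
    fix y assume "y \<in> vec.span {x}"
    then obtain c where y: "y = c *s x" by (auto simp: vec.span_singleton)
    have "vK y = c ^ (CARD('n) - 1) *s vK x"
      unfolding y vK_def geom_eval_scale[OF form_v] by (simp add: vec_eq_iff)
    then show "vK y \<in> vec.span {vK x}" by (simp add: vec.span_scale vec.span_base)
  qed
  moreover have "vK x \<in> vec.span (vK ` vec.span {x})" by (simp add: vec.span_base)
  ultimately have "vec.span (vK ` vec.span {x}) = vec.span {vK x}"
    by (intro equalityI vec.span_minimal) auto
  then show ?thesis by (simp add: ratmap_apply_def vK_def)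
qed

text \<open>Any equation of the \<open>j\<close>-th hypersurface is proportional to \<open>Q j\<close>.\<close>
lemma off_Q_point:
  assumes q: "\<And>j. Q_equation W j (q j)" and P: "P' \<in> proj_space - (\<Union>j. zero_locus (q j))"
  obtains x where "x \<noteq> 0" "P' = vec.span {x}" "\<And>j. geom_eval (Q j) x \<noteq> 0"
proof -
  obtain x where x: "x \<noteq> 0" "P' = vec.span {x}" using P by (auto simp: proj_space_def)
  have "geom_eval (Q j) x \<noteq> 0" for j
  proof -
    obtain c where c: "Q j = mconst c * q j" using q Q_vanishing Q_neq_0 unfolding Q_equation_def by blast
    then have "c \<noteq> 0" using Q_neq_0[of j] by (auto simp: rhomD[OF rhom_mconst])
    have form: "is_form (CARD('n) - 2) (q j)" using q[of j] by (simp add: Q_equation_def forms_vanishing_def)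
    obtain y where y: "y \<in> P'" "geom_eval (q j) y \<noteq> 0" using P by (auto simp: zero_locus_def)
    then obtain t where "y = t *s x" using x by (auto simp: vec.span_singleton)
    then have "geom_eval (q j) x \<noteq> 0" using y geom_eval_scale[OF form, of t x] by auto
    then show ?thesis using \<open>c \<noteq> 0\<close> by (simp add: c geval_simps)
  qed
  then show ?thesis using x that by blast
qed

lemma ratmap_injective:
  assumes q: "\<And>j. Q_equation W j (q j)"
  defines "Y \<equiv> proj_space - (\<Union>j. zero_locus (q j))"
  shows "ratmap_apply v ` Y \<subseteq> proj_space" "inj_on (ratmap_apply v) Y"
proof -
  show "ratmap_apply v ` Y \<subseteq> proj_space"
  proof (rule image_subsetI)
    fix P' assume "P' \<in> Y"
    then obtain x where x: "x \<noteq> 0" "P' = vec.span {x}" "\<And>j. geom_eval (Q j) x \<noteq> 0"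
      using off_Q_point[OF q] unfolding Y_def by blast
    have "vK x \<noteq> 0" using x(3) by (rule vK_neq_0)
    then show "ratmap_apply v P' \<in> proj_space" by (auto simp: x(2) ratmap_apply_span proj_space_def)
  qed
  show "inj_on (ratmap_apply v) Y"
  proof (rule inj_onI)
    fix P1 P2 assume P12: "P1 \<in> Y" "P2 \<in> Y" and eq: "ratmap_apply v P1 = ratmap_apply v P2"
    obtain x where x: "x \<noteq> 0" "P1 = vec.span {x}" "\<And>j. geom_eval (Q j) x \<noteq> 0"
      using off_Q_point[OF q] P12(1) unfolding Y_def by blast
    obtain y where y: "y \<noteq> 0" "P2 = vec.span {y}" "\<And>j. geom_eval (Q j) y \<noteq> 0"
      using off_Q_point[OF q] P12(2) unfolding Y_def by blast
    have "vK y \<in> vec.span {vK x}" using eq by (simp add: x(2) y(2) ratmap_apply_span vec.span_base)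
    then obtain c where "vK y = c *s vK x" by (auto simp: vec.span_singleton)
    then obtain t where t: "y = t *s x" using vK_injective[OF x(3) y(3) x(1)] by blast
    then have "t \<noteq> 0" using y(1) by auto
    then have "x = inverse t *s y" by (simp add: t vec_eq_iff)
    then have "x \<in> vec.span {y}" "y \<in> vec.span {x}" using t by (auto simp: vec.span_singleton)
    then show "P1 = P2" unfolding x(2) y(2) by (intro equalityI vec.span_minimal) auto
  qed
qed

section \<open>The inverse rational map\<close>
definition v_val :: "'k ^ 'n \<Rightarrow> 'k ^ 'n" where
  "v_val x = (\<chi> i. mval (v i) x)"

lemma UV_val:
  "mval (Q i) x * dotp (a i) x = dotp (P i) (v_val x)"
  "mval (Q i) x * dotp (b i) x = dotp (R i) (v_val x)"
proof -
  have "mval (U i) x = dotp (P i) (v_val x)" "mval (V i) x = dotp (R i) (v_val x)"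
    unfolding U_v V_v by (simp_all add: mval_simps dotp_def v_val_def)
  then show "mval (Q i) x * dotp (a i) x = dotp (P i) (v_val x)"
    "mval (Q i) x * dotp (b i) x = dotp (R i) (v_val x)"
    by (simp_all add: U_def V_def mval_simps)
qed

text \<open>For \<open>y = v(x)\<close> the \<open>i\<close>-th row is a multiple of the hyperplane spanned by
  \<open>x\<close> and \<open>W i\<close>, so that \<open>x\<close> solves the linear system with this matrix.\<close>
definition relations :: "'k ^ 'n \<Rightarrow> 'k ^ 'n ^ 'n" where
  "relations y = (\<chi> i. dotp (R i) y *s a i - dotp (P i) y *s b i)"

lemma relations_v_val: "relations (v_val x) = (\<chi> i. mval (Q i) x *s pencil a b x $ i)"
  by (simp add: relations_def pencil_def vec_eq_iff right_diff_distrib flip: UV_val)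

text \<open>On the image of \<open>v\<close> this is the relation \<open>\<Sum>\<^sub>i Q\<^sub>i H\<^sub>i =
  0\<close>. The sum is linear in \<open>y\<close> and the components of \<open>v\<close> are linearly independent, so
  it vanishes for every \<open>y\<close>.\<close>
lemma sum_relations: "(\<Sum>i\<in>UNIV. relations y $ i) = 0"
proof -
  define c where "c = (\<lambda>k l. \<Sum>i\<in>UNIV. R i $ l * a i $ k - P i $ l * b i $ k)"
  have coeff: "(\<Sum>i\<in>UNIV. relations y $ i) $ k = (\<Sum>l\<in>UNIV. c k l * y $ l)" for y k
  proof -
    have "(\<Sum>i\<in>UNIV. relations y $ i) $ k = (\<Sum>i\<in>UNIV. \<Sum>l\<in>UNIV. (R i $ l * a i $ k - P i $ l * b i $ k) * y $ l)"
      by (simp add: relations_def dotp_def sum_distrib_left sum_distrib_right algebra_simps sum_subtractf)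
    also have "\<dots> = (\<Sum>l\<in>UNIV. c k l * y $ l)"
      by (subst sum.swap) (simp add: c_def sum_distrib_right)
    finally show ?thesis .
  qed
  have "(\<Sum>l\<in>UNIV. mconst (c k l) * v l) = 0" for k
  proof (rule mval_eq_0I)
    fix x
    have "(\<Sum>i\<in>UNIV. relations (v_val x) $ i) = 0"
    proof (cases "x = 0")
      case True
      then show ?thesis by (simp add: relations_v_val pencil_def dotp_simps)
    next
      case False
      then show ?thesis
        unfolding relations_v_val using cofactor_row_relation[OF cof_pencil_mval False pencil_kills] by simp
    qed
    then show "mval (\<Sum>l\<in>UNIV. mconst (c k l) * v l) x = 0"
      using coeff[of "v_val x" k] by (simp add: mval_simps v_val_def)
  qed
  then have "c k l = 0" for k l by (rule v_independent)
  then have "(\<Sum>i\<in>UNIV. relations y $ i) $ k = 0" for k unfolding coeff by simp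
  then show ?thesis unfolding vec_eq_iff zero_index by blast
qed

definition poly_relations :: "('n, 'k) mpoly ^ 'n ^ 'n" where
  "poly_relations = (\<chi> i. linear_form (R i) *s mapv mconst (a i) - linear_form (P i) *s mapv mconst (b i))"

text \<open>The rows of \<open>relations y\<close> sum to zero, so the cofactors of all rows agree, and the choice of
  the row is immaterial.\<close>
definition row0 :: 'n where "row0 = (SOME j. True)"

definition inv_form :: "'n \<Rightarrow> ('n, 'k) mpoly" where
  "inv_form k = cof poly_relations row0 k"

definition inv_val where "inv_val y = (\<chi> i. mval (inv_form i) y)"

lemma form_inv_form: "is_form (CARD('n) - 1) (inv_form k)"
proof -
  have "is_form 1 (poly_relations $ i $ k)" for i k
    by (auto simp: poly_relations_def intro!: is_form_diff is_form_mconst_mult is_form_linear_form[unfolded One_nat_def]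
      simp: mult.commute[of _ "mconst _"])
  then show ?thesis unfolding inv_form_def using is_form_cof[of 1 poly_relations row0 k] by simp
qed

lemma mval_inv_form: "mval (inv_form k) y = cof (relations y) row0 k"
proof -
  have "(\<chi> i. mapv (\<lambda>p. mval p y) (poly_relations $ i)) = relations y"
    by (simp add: poly_relations_def relations_def vec_eq_iff mval_simps)
  then show ?thesis unfolding inv_form_def by (simp add: rhom_cof[OF rhom_mval])
qed

definition Q_prod where "Q_prod = (\<Prod>j\<in>UNIV. Q j)"

lemma form_Q_prod: "is_form (\<Sum>j\<in>(UNIV :: 'n set). CARD('n) - 2) Q_prod"
  unfolding Q_prod_def by (rule is_form_prod) (rule form_Q)

lemma Q_prod_neq_0: "Q_prod \<noteq> 0"
  unfolding Q_prod_def by (rule mpoly_prod_neq_0) (rule Q_neq_0)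

lemma mval_Q_prod: "mval Q_prod x = (\<Prod>j\<in>UNIV. mval (Q j) x)"
  by (simp add: Q_prod_def mval_simps)

text \<open>The cofactors of row \<open>row0\<close> pick up the factors \<open>Q\<^sub>i(x)\<close> with \<open>i
  \<noteq> row0\<close> from the rows and the remaining one from the cofactors of the matrix \<open>pencil a b
  x\<close>.\<close>
lemma inv_after_v: "inv_val (v_val x) = mval Q_prod x *s x"
proof -
  have "prod (\<lambda>i. mval (Q i) x) (- {row0}) * mval (Q row0) x = mval Q_prod x"
    unfolding mval_Q_prod by (subst prod.remove[of UNIV row0]) (auto simp: Compl_eq_Diff_UNIV mult.commute)
  then show ?thesis
    by (simp add: vec_eq_iff inv_val_def mval_inv_form relations_v_val cof_scale_rows cof_pencil_mval flip: mult.assoc)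
qed

lemma relations_kill_inv_val: "dotp (relations y $ i) (inv_val y) = 0"
proof -
  have *: "dotp r (inv_val y) = det (replace_row (relations y) row0 r)" for r
    by (simp add: det_replace_row dotp_def inv_val_def mval_inv_form)
  have other: "dotp (relations y $ i) (inv_val y) = 0" if "i \<noteq> row0" for i
    unfolding * using that by (intro det_identical_rows[of i row0]) (auto simp: row_def)
  show ?thesis
  proof (cases "i = row0")
    case True
    have "0 = dotp (\<Sum>i\<in>UNIV. relations y $ i) (inv_val y)" by (simp add: sum_relations dotp_simps)
    also have "\<dots> = dotp (relations y $ row0) (inv_val y) + (\<Sum>i\<in>UNIV - {row0}. dotp (relations y $ i) (inv_val y))"
      unfolding dotp_sum by (rule sum.remove) auto
    also have "(\<Sum>i\<in>UNIV - {row0}. dotp (relations y $ i) (inv_val y)) = 0" by (rule sum.neutral) (simp add: other)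
    finally show ?thesis using True by simp
  qed (rule other)
qed

text \<open>Comparing coefficients in \<open>v = C(U) = C(P(v))\<close> shows that \<open>P\<close> is a right inverse
  of \<open>C\<close>.\<close>
lemma coordinates_from_U: "(\<Sum>l\<in>UNIV. C i $ l * dotp (P l) y) = y $ i"
proof -
  define c where "c = (\<lambda>k. (\<Sum>l\<in>UNIV. C i $ l * P l $ k) - (if k = i then 1 else 0))"
  have "(\<Sum>k\<in>UNIV. mconst (c k) * v k) = 0"
  proof (rule mval_eq_0I)
    fix x
    have "(\<Sum>k\<in>UNIV. (\<Sum>l\<in>UNIV. C i $ l * P l $ k) * mval (v k) x) = (\<Sum>l\<in>UNIV. C i $ l * mval (U l) x)"
      unfolding U_v by (simp add: mval_simps sum_distrib_left sum_distrib_right mult.assoc) (rule sum.swap)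
    also have "\<dots> = mval (v i) x" by (subst v_U) (simp add: mval_simps)
    finally show "mval (\<Sum>k\<in>UNIV. mconst (c k) * v k) x = 0"
      by (simp add: mval_simps c_def left_diff_distrib sum_subtractf if_distrib[of "\<lambda>z. z * _"] cong: if_cong)
  qed
  then have "c k = 0" for k by (rule v_independent)
  then have c: "(\<Sum>l\<in>UNIV. C i $ l * P l $ k) = (if k = i then 1 else 0)" for k by (simp add: c_def)
  have "(\<Sum>l\<in>UNIV. C i $ l * dotp (P l) y) = (\<Sum>k\<in>UNIV. (\<Sum>l\<in>UNIV. C i $ l * P l $ k) * y $ k)"
    by (simp add: dotp_def sum_distrib_left sum_distrib_right mult.assoc) (rule sum.swap)
  then show ?thesis by (simp add: c if_distrib[of "\<lambda>z. z * _"] cong: if_cong)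
qed

text \<open>Let \<open>x\<close> be the value of the inverse at \<open>y\<close>. The matrix \<open>relations
  y\<close> kills \<open>x\<close>, which makes \<open>(P\<^sub>i(y), R\<^sub>i(y))\<close> a multiple
  \<open>m\<^sub>i\<close> of \<open>(a\<^sub>i(x), b\<^sub>i(x))\<close>, and then \<open>\<Sum>\<^sub>i m\<^sub>i
  H\<^sub>i(x) = 0\<close>. By uniqueness of the relation between the hyperplanes, the \<open>m\<^sub>i\<close> are
  proportional to the \<open>Q\<^sub>i(x)\<close>, that is, \<open>P(y)\<close> is proportional to
  \<open>P(v(x))\<close>.\<close>
lemma v_after_inv:
  assumes "mval Q_prod (inv_val y) \<noteq> 0"
  shows "\<exists>\<mu>. y = \<mu> *s v_val (inv_val y)"
proof -
  let ?x = "inv_val y"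
  have Qx: "mval (Q j) ?x \<noteq> 0" for j using assms by (simp add: mval_Q_prod)
  have "?x \<noteq> 0" using Qx[of row0] mval_form_0[OF form_Q] card_ge_3 by auto
  \<comment> \<open>The multiplier exists because \<open>a\<^sub>i\<close> and \<open>b\<^sub>i\<close> do not both vanish at the point.\<close>
  have "\<exists>\<mu>. dotp (P i) y = \<mu> * dotp (a i) ?x \<and> dotp (R i) y = \<mu> * dotp (b i) ?x" for i
  proof -
    have "geom_eval (Q j) (mapv to_ac ?x) \<noteq> 0" for j using Qx[of j] by (simp add: geom_eval_mapv)
    from off_base_locus[OF this, of i] have ab: "dotp (a i) ?x \<noteq> 0 \<or> dotp (b i) ?x \<noteq> 0"
      by (simp flip: rhom_dotp[OF rhom_to_ac])
    have eq: "dotp (R i) y * dotp (a i) ?x = dotp (P i) y * dotp (b i) ?x"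
      using relations_kill_inv_val[of y i] by (simp add: relations_def dotp_simps)
    show ?thesis
    proof (cases "dotp (a i) ?x = 0")
      case True
      then show ?thesis using ab eq by (intro exI[of _ "dotp (R i) y / dotp (b i) ?x"]) auto
    next
      case False
      then show ?thesis using eq by (intro exI[of _ "dotp (P i) y / dotp (a i) ?x"]) (simp add: field_simps)
    qed
  qed
  then obtain m where m: "\<And>i. dotp (P i) y = m i * dotp (a i) ?x" "\<And>i. dotp (R i) y = m i * dotp (b i) ?x" by metis
  have "relations y $ i = m i *s pencil a b ?x $ i" for i
    by (simp add: relations_def pencil_def m vec_eq_iff right_diff_distrib)
  then have "(\<Sum>i\<in>UNIV. m i *s pencil a b ?x $ i) = 0" using sum_relations[of y] by simp
  then have ratio: "m i * mval (Q row0) ?x = m row0 * mval (Q i) ?x" for i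
    by (rule row_relation_proportional[OF cof_pencil_mval \<open>?x \<noteq> 0\<close>])
  let ?\<mu> = "m row0 / mval (Q row0) ?x"
  have mi: "m i = ?\<mu> * mval (Q i) ?x" for i using ratio[of i] Qx[of row0] by (simp add: field_simps)
  have Py: "dotp (P i) y = ?\<mu> * dotp (P i) (v_val ?x)" for i
    unfolding m(1)[of i] UV_val(1)[of i ?x, symmetric] by (subst mi) (rule mult.assoc)
  have "y $ i = (?\<mu> *s v_val ?x) $ i" for i
  proof -
    have "y $ i = (\<Sum>l\<in>UNIV. C i $ l * dotp (P l) y)" by (rule coordinates_from_U[symmetric])
    also have "\<dots> = ?\<mu> * (\<Sum>l\<in>UNIV. C i $ l * dotp (P l) (v_val ?x))"
      by (simp add: Py sum_distrib_left mult_ac)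
    finally show ?thesis by (simp add: coordinates_from_U)
  qed
  then show ?thesis by (intro exI[of _ ?\<mu>]) (simp add: vec_eq_iff)
qed

lemma mval_inv_comp_v: "mval (ratmap_comp inv_form v i) x = mval Q_prod x * x $ i"
  using inv_after_v[of x] by (simp add: mval_ratmap_comp vec_eq_iff inv_val_def v_val_def)

lemma mval_v_comp_inv: "mval (ratmap_comp v inv_form i) y = v_val (inv_val y) $ i"
  by (simp add: mval_ratmap_comp inv_val_def v_val_def)

lemma mval_subst_inv: "mval (msubst mconst inv_form p) y = mval p (inv_val y)"
  using mval_ratmap_comp[of "\<lambda>_. p" inv_form undefined y] by (simp add: ratmap_comp_def inv_val_def)

text \<open>The pointwise statement holds where the product of the \<open>Q\<^sub>j\<close> does not vanish at the
  value of the inverse. This product, composed with the inverse, is not the zero polynomial: at \<open>y =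
  v(x)\<close> it is a power of \<open>\<Prod>\<^sub>j Q\<^sub>j(x)\<close> times \<open>\<Prod>\<^sub>j
  Q\<^sub>j(x)\<close>.\<close>
lemma ratmap_eq_v_inv: "ratmap_eq (ratmap_comp v inv_form) mvar"
  unfolding ratmap_eq_def
proof (intro allI)
  fix i j
  let ?M = "msubst mconst inv_form Q_prod" and ?T = "ratmap_comp v inv_form"
  obtain x where x: "mval Q_prod x \<noteq> 0" using mval_eq_0I[of Q_prod] Q_prod_neq_0 by metis
  have "mval ?M (v_val x) \<noteq> 0" using x by (simp add: mval_subst_inv inv_after_v mval_scale[OF form_Q_prod])
  then have "?M \<noteq> 0" by (auto simp: mval_simps)
  moreover have "?M * (?T i * mvar j - ?T j * mvar i) = 0"
  proof (rule mval_eq_0I)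
    fix y
    have "v_val (inv_val y) $ i * y $ j = v_val (inv_val y) $ j * y $ i" if nz: "mval Q_prod (inv_val y) \<noteq> 0"
    proof -
      obtain m where m: "y = m *s v_val (inv_val y)" using v_after_inv[OF nz] by blast
      have "y $ l = m * v_val (inv_val y) $ l" for l by (subst m) simp
      then show ?thesis by simp
    qed
    then show "mval (?M * (?T i * mvar j - ?T j * mvar i)) y = 0"
      by (auto simp: mval_simps mval_subst_inv mval_v_comp_inv)
  qed
  ultimately show "?T i * mvar j = ?T j * mvar i" using mpoly_mult_eq_0 by fastforce
qed

lemma cremona: "is_cremona v"
proof -
  have ratmap: "is_ratmap f" if "\<And>i. is_form d (f i)" "f i \<noteq> 0" for f :: "'n \<Rightarrow> ('n, 'k) mpoly" and d i
    using that unfolding is_ratmap_def by blast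
  obtain x where x: "mval Q_prod x \<noteq> 0" "mval (v row0) x \<noteq> 0"
  proof -
    have "Q_prod * v row0 \<noteq> 0" using mpoly_mult_eq_0[of Q_prod "v row0"] Q_prod_neq_0 v_neq_0[of row0] by metis
    then have "\<exists>x. mval (Q_prod * v row0) x \<noteq> 0" using mval_eq_0I[of "Q_prod * v row0"] by metis
    then show thesis using that by (auto simp: mval_simps)
  qed
  have "x \<noteq> 0" using x(2) mval_form_0[OF form_v] card_ge_3 by auto
  then obtain k where k: "x $ k \<noteq> 0" by (auto simp: vec_eq_iff)
  have gvk: "mval (ratmap_comp inv_form v k) x \<noteq> 0" using x k by (simp add: mval_inv_comp_v)
  have v: "is_ratmap v" using form_v v_neq_0 by (rule ratmap)
  have "inv_form k \<noteq> 0" using gvk by (auto simp: mval_ratmap_comp mval_simps)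
  with form_inv_form have inv: "is_ratmap inv_form" by (rule ratmap)
  have gv: "is_ratmap (ratmap_comp inv_form v)"
  proof (rule ratmap)
    show "is_form ((CARD('n) - 1) * (CARD('n) - 1)) (ratmap_comp inv_form v i)" for i
      unfolding ratmap_comp_def by (rule is_form_msubst[OF form_inv_form form_v])
    show "ratmap_comp inv_form v k \<noteq> 0" using gvk by (auto simp: mval_simps)
  qed
  have vg: "is_ratmap (ratmap_comp v inv_form)"
  proof (rule ratmap)
    show "is_form ((CARD('n) - 1) * (CARD('n) - 1)) (ratmap_comp v inv_form i)" for i
      unfolding ratmap_comp_def by (rule is_form_msubst[OF form_v form_inv_form])
    have "mval (ratmap_comp v inv_form row0) (v_val x) \<noteq> 0"
      using x unfolding mval_v_comp_inv inv_after_v by (simp add: v_val_def mval_scale[OF form_v])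
    then show "ratmap_comp v inv_form row0 \<noteq> 0" by (auto simp: mval_simps)
  qed
  have "ratmap_eq (ratmap_comp inv_form v) mvar"
    unfolding ratmap_eq_def
  proof (intro allI)
    fix i j
    show "ratmap_comp inv_form v i * mvar j = ratmap_comp inv_form v j * mvar i"
      by (rule mval_eqI) (simp add: mval_simps mval_inv_comp_v)
  qed
  then show ?thesis unfolding is_cremona_def using v inv gv vg ratmap_eq_v_inv by blast
qed

end

section \<open>General position is dense and open\<close>
definition coords_a :: "('n::finite \<times> bool \<times> 'n \<Rightarrow> 'k) \<Rightarrow> 'n \<Rightarrow> 'k ^ 'n" where
  "coords_a c i = (\<chi> k. c (i, False, k))"

definition coords_b :: "('n::finite \<times> bool \<times> 'n \<Rightarrow> 'k) \<Rightarrow> 'n \<Rightarrow> 'k ^ 'n" where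
  "coords_b c i = (\<chi> k. c (i, True, k))"

lemma cut_out_coords: "cut_out c i = {v. dotp (coords_a c i) v = 0 \<and> dotp (coords_b c i) v = 0}"
  by (auto simp: cut_out_def dotp_def coords_a_def coords_b_def all_bool_eq)

definition frame_det :: "('n::finite \<times> bool \<times> 'n \<Rightarrow> 'a::comm_ring_1) \<Rightarrow> 'a" where
  "frame_det c = det (\<chi> i. coords_a c i)"

text \<open>By Cramer's rule, the coordinates of the \<open>b\<close>-forms in the basis of the
  \<open>a\<close>-forms, multiplied by the determinant \<open>frame_det c\<close> to clear denominators.\<close>
definition frame_minor :: "('n::finite \<times> bool \<times> 'n \<Rightarrow> 'a::comm_ring_1) \<Rightarrow> 'n \<Rightarrow> 'n \<Rightarrow> 'a" where
  "frame_minor c i k = det (replace_row (\<chi> i. coords_a c i) k (coords_b c i))"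

lemma rhom_frame:
  assumes "rhom h"
  shows "h (frame_det c) = frame_det (h \<circ> c)" "h (frame_minor c i k) = frame_minor (h \<circ> c) i k"
  unfolding frame_det_def frame_minor_def rhom_det[OF assms]
  by (auto simp: coords_a_def coords_b_def intro!: arg_cong[of _ _ det] simp: vec_eq_iff)

definition genericity_poly :: "('n::finite \<times> bool \<times> 'n, 'k::field_char_0) mpoly" where
  "genericity_poly = frame_det mvar * (\<Prod>(i, k)\<in>{(i, k). i \<noteq> k}. frame_minor mvar i k) *
     (\<Prod>(i, i', j, j')\<in>{(i, i', j, j'). distinct [i, i', j, j']}.
        frame_minor mvar i j * frame_minor mvar i' j' - frame_minor mvar i j' * frame_minor mvar i' j)"

lemma eval_frame:
  "msubst id c (frame_det mvar) = frame_det c" "msubst id c (frame_minor mvar i k) = frame_minor c i k"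
  using rhom_frame[OF rhom_eval, of c mvar] by (simp_all add: comp_def msubst_mvar[OF rhom_id])

lemma eval_genericity_poly:
  fixes c :: "'n::finite \<times> bool \<times> 'n \<Rightarrow> 'k::field_char_0"
  shows "msubst id c genericity_poly \<noteq> 0 \<longleftrightarrow> frame_det c \<noteq> 0 \<and> generic_matrix (frame_minor c)"
  by (auto simp: genericity_poly_def rhomD[OF rhom_eval] eval_frame generic_matrix_def case_prod_unfold) blast

lemma frame_minor_eq:
  fixes c :: "'n::finite \<times> bool \<times> 'n \<Rightarrow> 'k::field"
  assumes expand: "\<And>x. x = (\<Sum>k\<in>UNIV. dotp (coords_a c k) x *s e k)"
  shows "frame_minor c i k = frame_det c * dotp (coords_b c i) (e k)"
proof -
  let ?A = "\<chi> i. coords_a c i" and ?r = "coords_b c i"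
  have "?r = (\<Sum>l\<in>UNIV. dotp ?r (e l) *s coords_a c l)"
  proof -
    have "?r $ m = (\<Sum>l\<in>UNIV. dotp ?r (e l) *s coords_a c l) $ m" for m
    proof -
      have "?r $ m = dotp ?r (axis m 1)" by simp
      also have "\<dots> = dotp ?r (\<Sum>l\<in>UNIV. dotp (coords_a c l) (axis m 1) *s e l)"
        by (subst expand[of "axis m 1"]) (rule refl)
      finally show ?thesis by (simp add: dotp_sum dotp_simps mult.commute)
    qed
    then show ?thesis by (simp add: vec_eq_iff)
  qed
  then have "frame_minor c i k = det (replace_row ?A k (\<Sum>l\<in>UNIV. dotp ?r (e l) *s coords_a c l))"
    by (simp only: frame_minor_def)
  also have "\<dots> = (\<Sum>l\<in>UNIV. dotp ?r (e l) * det (replace_row ?A k (coords_a c l)))"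
    by (rule det_replace_row_sum) simp
  also have "\<dots> = (\<Sum>l\<in>UNIV. if l = k then dotp ?r (e k) * frame_det c else 0)"
  proof (rule sum.cong)
    fix l
    have "det (replace_row ?A k (coords_a c l)) = 0" if "l \<noteq> k"
      using that by (intro det_identical_rows[of k l]) (auto simp: row_def)
    moreover have "replace_row ?A k (coords_a c k) = ?A" by (auto simp: vec_eq_iff)
    ultimately show "dotp ?r (e l) * det (replace_row ?A k (coords_a c l)) = (if l = k then dotp ?r (e k) * frame_det c else 0)"
      by (auto simp: frame_det_def)
  qed simp
  finally show ?thesis by (simp add: mult.commute)
qed

text \<open>A witness is the standard basis for the \<open>a i\<close> and \<open>b\<^sub>i\<^sub>k = 1 + f i \<sqdot>
  f k\<close> for an injective \<open>f\<close> into the natural numbers: the \<open>2 \<times> 2\<close> minors are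
  \<open>(f i - f i') (f j - f j')\<close>.\<close>
lemma genericity_poly_neq_0: "genericity_poly \<noteq> (0 :: ('n::finite \<times> bool \<times> 'n, 'k::field_char_0) mpoly)"
proof -
  obtain f :: "'n \<Rightarrow> nat" where f: "inj f"
    using finite_imp_inj_to_nat_seg[of "UNIV :: 'n set"] by auto
  define c :: "'n \<times> bool \<times> 'n \<Rightarrow> 'k" where
    "c = (\<lambda>(i, s, k). if s then 1 + of_nat (f i) * of_nat (f k) else if k = i then 1 else 0)"
  have a: "coords_a c i = axis i 1" for i by (simp add: coords_a_def c_def vec_eq_iff axis_def)
  have b: "coords_b c i $ k = 1 + of_nat (f i) * of_nat (f k)" for i k by (simp add: coords_b_def c_def)
  have d: "frame_det c = 1"
  proof -
    have "(\<chi> i. coords_a c i) = mat 1" by (simp add: a vec_eq_iff mat_def axis_def) 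
    then show ?thesis by (simp add: frame_det_def)
  qed
  have "x = (\<Sum>k\<in>UNIV. dotp (coords_a c k) x *s axis k 1)" for x :: "'k ^ 'n"
    by (simp add: a) (simp add: vec_eq_iff axis_def if_distrib[of "\<lambda>z. _ * z"] cong: if_cong)
  then have entry: "frame_minor c i k = 1 + of_nat (f i) * of_nat (f k)" for i k
    using frame_minor_eq[of c "\<lambda>k. axis k 1" i k] by (simp add: d b)
  have "generic_matrix (frame_minor c)"
    unfolding generic_matrix_def entry
  proof (intro conjI allI impI)
    fix i k :: 'n
    have "(of_nat (1 + f i * f k) :: 'k) \<noteq> 0" by (subst of_nat_eq_0_iff) simp
    then show "(1 + of_nat (f i) * of_nat (f k) :: 'k) \<noteq> 0" by simp
  next
    fix i i' j j' :: 'n assume "distinct [i, i', j, j']"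
    then have ne: "f i \<noteq> f i'" "f j \<noteq> f j'" using f by (auto simp: inj_eq)
    have "(1 + of_nat (f i) * of_nat (f j)) * (1 + of_nat (f i') * of_nat (f j')) -
      (1 + of_nat (f i) * of_nat (f j')) * (1 + of_nat (f i') * of_nat (f j)) =
      ((of_nat (f i) - of_nat (f i')) * (of_nat (f j) - of_nat (f j')) :: 'k)"
      by (simp add: algebra_simps)
    moreover have "\<dots> \<noteq> 0" using ne by simp
    ultimately show "(1 + of_nat (f i) * of_nat (f j)) * (1 + of_nat (f i') * of_nat (f j')) \<noteq>
      (1 + of_nat (f i) * of_nat (f j')) * (1 + of_nat (f i') * of_nat (f j) :: 'k)" by auto
  qed
  then have "msubst id c genericity_poly \<noteq> 0" using d by (simp add: eval_genericity_poly)
  then show ?thesis by (auto simp: rhomD[OF rhom_eval])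
qed

text \<open>The vertices are the columns of the inverse of the matrix with rows \<open>a i\<close>.\<close>
lemma ex_general_position:
  fixes c :: "'n::finite \<times> bool \<times> 'n \<Rightarrow> 'k::field_char_0"
  assumes "msubst id c genericity_poly \<noteq> 0" "CARD('n) \<ge> 3"
  shows "\<exists>e. general_position (coords_a c) (coords_b c) e"
proof -
  let ?A = "\<chi> i. coords_a c i"
  have d: "frame_det c \<noteq> 0" and gen: "generic_matrix (frame_minor c)" using assms(1) by (auto simp: eval_genericity_poly)
  then obtain B where B: "?A ** B = mat 1" "B ** ?A = mat 1"
    using invertible_det_nz[of ?A] unfolding frame_det_def invertible_def by blast
  define e where "e = (\<lambda>k. column k B)"
  have dual: "dotp (coords_a c i) (e k) = (if i = k then 1 else 0)" for i k
  proof -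
    have "dotp (coords_a c i) (e k) = (?A ** B) $ i $ k"
      by (simp add: dotp_def e_def column_def matrix_matrix_mult_def)
    then show ?thesis by (simp add: B mat_def)
  qed
  have expand: "x = (\<Sum>k\<in>UNIV. dotp (coords_a c k) x *s e k)" for x
  proof -
    have "x = B *v (?A *v x)" by (simp add: matrix_vector_mul_assoc B)
    also have "\<dots> = (\<Sum>k\<in>UNIV. (?A *v x) $ k *s column k B)" by (rule matrix_mult_sum)
    finally show ?thesis by (simp add: e_def matrix_vector_mult_def dotp_def)
  qed
  have "generic_matrix (\<lambda>i k. dotp (coords_b c i) (e k))"
    unfolding generic_matrix_def
  proof (intro conjI allI impI)
    show "dotp (coords_b c i) (e k) \<noteq> 0" if "i \<noteq> k" for i k
      using gen that frame_minor_eq[OF expand, of i k] by (auto simp: generic_matrix_def)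
    fix i i' j j' :: 'n assume dis: "distinct [i, i', j, j']"
    have "frame_minor c i j * frame_minor c i' j' \<noteq> frame_minor c i j' * frame_minor c i' j"
      using gen dis unfolding generic_matrix_def by blast
    then show "dotp (coords_b c i) (e j) * dotp (coords_b c i') (e j') \<noteq>
      dotp (coords_b c i) (e j') * dotp (coords_b c i') (e j)"
      unfolding frame_minor_eq[OF expand] by (auto simp: mult_ac)
  qed
  then show ?thesis using dual expand assms(2) unfolding general_position_def by blast
qed

definition basic_open :: "('n \<times> bool \<times> 'n, 'k::field) mpoly \<Rightarrow> ('n \<Rightarrow> ('k ^ 'n) set) set" where
  "basic_open F = {W \<in> codim2_tuples. \<exists>c. W = cut_out c \<and> msubst id c F \<noteq> 0}"

lemma general_position_cut_out:
  assumes "general_position (coords_a c) (coords_b c) e"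
  shows "general_position.W (coords_a c) (coords_b c) = cut_out c"
  by (simp add: fun_eq_iff general_position.W_def[OF assms] cut_out_coords)

lemma cut_out_codim2:
  fixes c :: "'n::finite \<times> bool \<times> 'n \<Rightarrow> 'k::field_char_0"
  assumes "msubst id c genericity_poly \<noteq> 0" "CARD('n) \<ge> 3"
  shows "cut_out c \<in> codim2_tuples"
  using ex_general_position[OF assms] general_position.W_codim2 general_position_cut_out by metis

text \<open>Stated for coefficients, the property avoids comparing the different equations that cut out the same
  subspaces, and it passes to intersections by multiplying the polynomials. For a basic open set the factor
  \<open>genericity_poly\<close> ensures that the subspaces cut out have codimension two.\<close>
lemma open_contains_principal:
  fixes S :: "('n::finite \<Rightarrow> ('k::field_char_0 ^ 'n) set) set"
  assumes n: "CARD('n) \<ge> 3"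
    and "generate_topology_on (range basic_open) S" "S \<noteq> {}"
  shows "\<exists>G. G \<noteq> 0 \<and> (\<forall>c. msubst id c G \<noteq> 0 \<longrightarrow> cut_out c \<in> S)"
  using assms(2,3)
proof (induction rule: generate_topology_on.induct)
  case (Int S T)
  then obtain G H where "G \<noteq> 0" "\<forall>c. msubst id c G \<noteq> 0 \<longrightarrow> cut_out c \<in> S"
    "H \<noteq> 0" "\<forall>c. msubst id c H \<noteq> 0 \<longrightarrow> cut_out c \<in> T" by blast
  moreover have "msubst id c (G * H) = msubst id c G * msubst id c H" for c
    by (rule rhomD(3)[OF rhom_eval])
  ultimately have "G * H \<noteq> 0 \<and> (\<forall>c. msubst id c (G * H) \<noteq> 0 \<longrightarrow> cut_out c \<in> S \<inter> T)"
    using mpoly_mult_eq_0[of G H] by fastforce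
  then show ?case ..
next
  case (UN K)
  then obtain k where k: "k \<in> K" "k \<noteq> {}" by blast
  then show ?case using UN.IH[OF k] by blast
next
  case (Basis S)
  then obtain F where F: "S = basic_open F" by blast
  have "F \<noteq> 0" using Basis(2) by (auto simp: F basic_open_def rhomD[OF rhom_eval])
  then have "F * genericity_poly \<noteq> 0" using genericity_poly_neq_0 mpoly_mult_eq_0 by blast
  moreover have "cut_out c \<in> S" if "msubst id c (F * genericity_poly) \<noteq> 0" for c
    using that cut_out_codim2[OF _ n, of c] by (auto simp: F basic_open_def rhomD[OF rhom_eval])
  ultimately show ?case by blast
qed simp

lemma dense_open_basic:
  assumes n: "CARD('n::finite) \<ge> 3"
  shows "dense_open_in zariski_codim2 (basic_open (genericity_poly :: ('n \<times> bool \<times> 'n, 'k::field_char_0) mpoly))"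
proof -
  let ?U = "basic_open (genericity_poly :: ('n \<times> bool \<times> 'n, 'k) mpoly)"
  have z: "zariski_codim2 = topology_generated_by (range basic_open)"
    unfolding zariski_codim2_def basic_open_def ..
  have "openin zariski_codim2 ?U" unfolding z by (rule topology_generated_by_Basis) simp
  moreover have "?U \<inter> S \<noteq> {}" if S: "openin zariski_codim2 S" "S \<noteq> {}" for S
  proof -
    have "generate_topology_on (range basic_open) S"
      using S(1) unfolding z openin_topology_generated_by_iff .
    then obtain G where G: "G \<noteq> 0" "\<And>c. msubst id c G \<noteq> 0 \<Longrightarrow> cut_out c \<in> S"
      using open_contains_principal[OF n _ S(2)] by blast
    obtain c where c: "msubst id c G \<noteq> 0" "msubst id c genericity_poly \<noteq> 0"
      using common_nonroot[of "{G, genericity_poly}"] G(1) genericity_poly_neq_0 by auto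
    have "cut_out c \<in> ?U" using c(2) cut_out_codim2[OF c(2) n] by (auto simp: basic_open_def)
    then show ?thesis using G(2)[OF c(1)] by blast
  qed
  ultimately show ?thesis unfolding dense_open_in_def dense_intersects_open by blast
qed

section \<open>The Cremona transformation\<close>
lemma (in general_position) ex_linear_system_basis:
  assumes "lin_sys_basis W v"
  shows "\<exists>C P R. linear_system_basis a b e v C P R"
proof -
  have "\<exists>c. p = (\<Sum>l\<in>UNIV. mconst (c $ l) * v l)" if "p \<in> lin_sys W" for p
  proof -
    have "p \<in> mpoly.span (range v)" using that assms by (simp add: lin_sys_basis_def)
    then obtain c where "p = (\<Sum>i\<in>UNIV. mconst (c i) * v i)" unfolding span_range_iff by blast
    then show ?thesis by (intro exI[of _ "\<chi> l. c l"]) simp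
  qed
  then obtain f where f: "\<And>p. p \<in> lin_sys W \<Longrightarrow> p = (\<Sum>l\<in>UNIV. mconst (f p $ l) * v l)" by metis
  have v: "v i \<in> lin_sys W" for i
    using assms mpoly.span_base[of "v i" "range v"] by (simp add: lin_sys_basis_def)
  let ?C = "\<lambda>i. \<chi> l. mval (v i) (e l) / mval (Q l) (e l)"
  have "linear_system_basis a b e v ?C (\<lambda>i. f (U i)) (\<lambda>i. f (V i))"
  proof unfold_locales
    show "v i = (\<Sum>l\<in>UNIV. mconst (?C i $ l) * U l)" for i using lin_sys_expand[OF v] by simp
  qed (use assms f[OF lin_sys_UV(1)] f[OF lin_sys_UV(2)] in auto)
  then show ?thesis by blast
qed

theorem proposition3p5:
  assumes "CARD('n::finite) = n + 1" and "n \<ge> 2"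
  shows "\<exists>U :: ('n \<Rightarrow> ('k::field_char_0 ^ 'n) set) set.
    dense_open_in zariski_codim2 U \<and>
    (\<forall>W\<in>U.
       (\<forall>j. \<exists>q. Q_equation W j q) \<and>
       mpoly.dim (lin_sys W) = n + 1 \<and>
       (\<forall>q v. (\<forall>j. Q_equation W j (q j)) \<and> lin_sys_basis W v \<longrightarrow>
          ratmap_apply v ` (proj_space - (\<Union>j. zero_locus (q j))) \<subseteq> proj_space \<and>
          inj_on (ratmap_apply v) (proj_space - (\<Union>j. zero_locus (q j))) \<and>
          is_cremona v))"
proof (intro exI conjI ballI)
  have n: "CARD('n) \<ge> 3" using assms by simp
  let ?U = "basic_open (genericity_poly :: ('n \<times> bool \<times> 'n, 'k) mpoly)"
  show "dense_open_in zariski_codim2 ?U" using n by (rule dense_open_basic)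
  fix W' :: "'n \<Rightarrow> ('k ^ 'n) set" assume "W' \<in> ?U"
  then obtain c where c: "W' = cut_out c" "msubst id c genericity_poly \<noteq> 0" by (auto simp: basic_open_def)
  then obtain e where e: "general_position (coords_a c) (coords_b c) e" using ex_general_position[OF _ n] by blast
  interpret general_position "coords_a c" "coords_b c" e by (rule e)
  have W': "W' = W" using general_position_cut_out[OF e] c(1) by simp
  show "\<forall>j. \<exists>q. Q_equation W' j q" unfolding W' using Q_equation_Q by blast
  show "mpoly.dim (lin_sys W') = n + 1" unfolding W' using dim_lin_sys assms by simp
  show "\<forall>q v. (\<forall>j. Q_equation W' j (q j)) \<and> lin_sys_basis W' v \<longrightarrow>
          ratmap_apply v ` (proj_space - (\<Union>j. zero_locus (q j))) \<subseteq> proj_space \<and>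
          inj_on (ratmap_apply v) (proj_space - (\<Union>j. zero_locus (q j))) \<and>
          is_cremona v"
    unfolding W'
  proof (intro allI impI, elim conjE)
    fix q v assume q: "\<forall>j. Q_equation W j (q j)" and v: "lin_sys_basis W v"
    obtain C P R where "linear_system_basis (coords_a c) (coords_b c) e v C P R"
      using ex_linear_system_basis[OF v] by blast
    then interpret linear_system_basis "coords_a c" "coords_b c" e v C P R .
    show "ratmap_apply v ` (proj_space - (\<Union>j. zero_locus (q j))) \<subseteq> proj_space \<and>
          inj_on (ratmap_apply v) (proj_space - (\<Union>j. zero_locus (q j))) \<and> is_cremona v"
      using ratmap_injective[of q] q cremona by blast
  qed
qed

end
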